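(* Let $A=\mathbb{F}_q[T]$, where $q$ is a power of a prime $p$. Then the order of vanishing of $\zeta(s)=\zeta_A(s)$ at $-j$, for $j$ a positive integer, is an invariant of the action of $S_{(q)}$ on the positive integers; that is, for every positive integer $j$ and every $\rho_\ast\in S_{(q)}$, the order of vanishing of $\zeta(s)$ at $-j$ equals its order of vanishing at $-\rho_\ast(j)$.
   Context: Let $k_\infty=\mathbb{F}_q((1/T))$, let $\mathbb{C}_\infty$ be the completion of an algebraic closure of $k_\infty$, and let $\pi$ be a positive uniformizer of $k_\infty$, i.e. $\pi=T^{-1}u$ with $u$ a $1$-unit. For monic $f\in A$ of degree $e$ put $\langle f\rangle=\pi^ef$, a $1$-unit, which may be raised to powers in $\mathbb{Z}_p$ via the binomial series. For $s=(x,y)\in\mathbb{C}_\infty^\ast\times\mathbb{Z}_p$ define $\zeta_A(s)=\zeta_A(x,y)=\sum_{e=0}^\infty x^{-e}\Big(\sum_{f\text{ monic},\,\deg f=e}\langle f\rangle^{-y}\Big)$; for fixed $y$ this is known to be an entire power series in $x^{-1}$. The integer $-j$ is identified with the point $s_{-j}=(\pi^{j},-j)$. The order of zero of $\zeta_A$ at $(x_0,y_0)$ is the order of zero of $x\mapsto\zeta_A(x,y_0)$ at $x=x_0$ (it is $0$ if the value there is nonzero). $S_{(q)}$: for a permutation $\rho$ of $\{0,1,2,\dots\}$ and $x=\sum_{i\ge0}c_iq^i\in\mathbb{Z}_p$ with $0\le c_i<q$, put $\rho_\ast(x)=\sum_{i\ge0}c_iq^{\rho(i)}$; $S_{(q)}$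 is the group of all bijections $\rho_\ast$ of $\mathbb{Z}_p$. These permute the positive integers. *)

theory Defs
  imports "HOL-Analysis.Analysis" "HOL-Algebra.Algebraic_Closure_Type"
begin

section \<open>The ring of p-adic integers\<close>

text \<open>
  The inverse limit of the rings \<open>\<int>/p\<^sup>n\<int>\<close>, residues being represented by the integers
  \<open>0, \<dots>, p\<^sup>n - 1\<close>.  The prime is the characteristic of the finite field \<open>'a\<close>; this is the only
  role of the type argument.
\<close>

typedef (overloaded) ('a :: "{field, finite}") padic_int =
    "{x :: nat \<Rightarrow> int. \<forall>n. x n = x (Suc n) mod int CHAR('a) ^ n}"
  morphisms padic_nth Abs_padic_int
  by (rule exI[of _ "\<lambda>_. 0"]) simp

setup_lifting type_definition_padic_int

lemma prime_CHAR_finite_field: "normalization_semidom_class.prime (int CHAR('a :: {field, finite}))"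
  using prime_CHAR_semidom[where 'a = 'a] finite_imp_CHAR_pos[where 'a = 'a] by simp

lemma padic_nth_Suc:
  fixes x :: "'a :: {field, finite} padic_int"
  shows "padic_nth x (Suc n) mod int CHAR('a) ^ n = padic_nth x n"
  using padic_nth[of x] unfolding mem_Collect_eq by metis

lemma padic_nth_mod:
  fixes x :: "'a :: {field, finite} padic_int"
  assumes "m \<le> n"
  shows "padic_nth x n mod int CHAR('a) ^ m = padic_nth x m"
  using assms
proof (induction n rule: dec_induct)
  case base
  have "padic_nth x m = padic_nth x (Suc m) mod int CHAR('a) ^ m"
    by (simp add: padic_nth_Suc)
  then show ?case by (metis mod_mod_trivial)
next
  case (step n)
  have "padic_nth x (Suc n) mod int CHAR('a) ^ m =
        padic_nth x (Suc n) mod int CHAR('a) ^ n mod int CHAR('a) ^ m"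
    using step.hyps by (simp add: mod_mod_cancel le_imp_power_dvd)
  then show ?case using step.IH by (simp add: padic_nth_Suc)
qed

lemma padic_nth_self_mod [simp]:
  fixes x :: "'a :: {field, finite} padic_int"
  shows "padic_nth x n mod int CHAR('a) ^ n = padic_nth x n"
  by (rule padic_nth_mod) simp

lemma mod_power_Suc_mod: "(a :: int) mod b ^ Suc n mod b ^ n = a mod b ^ n"
  by (simp add: mod_mod_cancel)

lemma padic_int_eqI: "(\<And>n. padic_nth x n = padic_nth y n) \<Longrightarrow> x = y"
  by (simp add: padic_nth_inject[symmetric] fun_eq_iff)

instantiation padic_int :: ("{field, finite}") comm_ring_1
begin

lift_definition zero_padic_int :: "'a padic_int" is "\<lambda>_. 0"
  by simp

lift_definition one_padic_int :: "'a padic_int" is "\<lambda>n. 1 mod int CHAR('a) ^ n"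
  by (simp add: mod_mod_cancel)

lift_definition plus_padic_int :: "'a padic_int \<Rightarrow> 'a padic_int \<Rightarrow> 'a padic_int"
  is "\<lambda>x y n. (x n + y n) mod int CHAR('a) ^ n"
  by (unfold mod_power_Suc_mod) (metis mod_add_eq)

lift_definition minus_padic_int :: "'a padic_int \<Rightarrow> 'a padic_int \<Rightarrow> 'a padic_int"
  is "\<lambda>x y n. (x n - y n) mod int CHAR('a) ^ n"
  by (unfold mod_power_Suc_mod) (metis mod_diff_eq)

lift_definition uminus_padic_int :: "'a padic_int \<Rightarrow> 'a padic_int"
  is "\<lambda>x n. (- x n) mod int CHAR('a) ^ n"
  by (unfold mod_power_Suc_mod) (metis mod_minus_eq)

lift_definition times_padic_int :: "'a padic_int \<Rightarrow> 'a padic_int \<Rightarrow> 'a padic_int"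
  is "\<lambda>x y n. (x n * y n) mod int CHAR('a) ^ n"
  by (unfold mod_power_Suc_mod) (metis mod_mult_eq)

instance
proof
  fix a b c :: "'a padic_int"
  show "a * b * c = a * (b * c)"
    by (rule padic_int_eqI) (simp add: times_padic_int.rep_eq mod_simps mult.assoc)
  show "a * b = b * a"
    by (rule padic_int_eqI) (simp add: times_padic_int.rep_eq mult.commute)
  show "1 * a = a"
    by (rule padic_int_eqI) (simp add: times_padic_int.rep_eq one_padic_int.rep_eq mod_simps)
  show "a + b + c = a + (b + c)"
    by (rule padic_int_eqI) (simp add: plus_padic_int.rep_eq mod_simps add.assoc)
  show "a + b = b + a"
    by (rule padic_int_eqI) (simp add: plus_padic_int.rep_eq add.commute)
  show "0 + a = a"
    by (rule padic_int_eqI) (simp add: plus_padic_int.rep_eq zero_padic_int.rep_eq)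
  show "- a + a = 0"
    by (rule padic_int_eqI)
       (simp add: plus_padic_int.rep_eq zero_padic_int.rep_eq uminus_padic_int.rep_eq mod_simps)
  show "a - b = a + - b"
    by (rule padic_int_eqI)
       (simp add: plus_padic_int.rep_eq minus_padic_int.rep_eq uminus_padic_int.rep_eq mod_simps)
  show "(a + b) * c = a * c + b * c"
    by (rule padic_int_eqI)
       (simp add: plus_padic_int.rep_eq times_padic_int.rep_eq mod_simps distrib_right)
  have "int CHAR('a) > 1"
    using prime_gt_1_int[OF prime_CHAR_finite_field[where 'a = 'a]] .
  hence "padic_nth (0 :: 'a padic_int) 1 \<noteq> padic_nth 1 1"
    by (simp add: zero_padic_int.rep_eq one_padic_int.rep_eq)
  thus "(0 :: 'a padic_int) \<noteq> 1" by metis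
qed

end

instance padic_int :: ("{field, finite}") idom
proof
  fix a b :: "'a padic_int"
  define p where "p = int CHAR('a)"
  have p: "normalization_semidom_class.prime p" unfolding p_def by (rule prime_CHAR_finite_field)
  assume "a \<noteq> 0" "b \<noteq> 0"
  then obtain m n where "padic_nth a m \<noteq> 0" "padic_nth b n \<noteq> 0"
    by (metis padic_int_eqI zero_padic_int.rep_eq)
  moreover have "padic_nth a (m + n) mod p ^ m = padic_nth a m"
                "padic_nth b (m + n) mod p ^ n = padic_nth b n"
    unfolding p_def by (simp_all add: padic_nth_mod)
  ultimately have "\<not> p ^ m dvd padic_nth a (m + n)" "\<not> p ^ n dvd padic_nth b (m + n)"
    by (auto simp: dvd_eq_mod_eq_0)
  moreover from this have "padic_nth a (m + n) \<noteq> 0" "padic_nth b (m + n) \<noteq> 0"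
    by auto
  ultimately have "multiplicity p (padic_nth a (m + n) * padic_nth b (m + n)) < m + n"
    using p by (subst prime_elem_multiplicity_mult_distrib)
               (auto intro!: add_strict_mono multiplicity_lessI dest: prime_gt_1_int)
  hence "\<not> p ^ (m + n) dvd padic_nth a (m + n) * padic_nth b (m + n)"
    using \<open>padic_nth a (m + n) \<noteq> 0\<close> \<open>padic_nth b (m + n) \<noteq> 0\<close> p
    by (subst power_dvd_iff_le_multiplicity) (auto simp: not_le dest: prime_gt_1_int)
  hence "padic_nth (a * b) (m + n) \<noteq> 0"
    by (simp add: times_padic_int.rep_eq p_def dvd_eq_mod_eq_0)
  thus "a * b \<noteq> 0" by (auto simp: zero_padic_int.rep_eq)
qed

lemma padic_nth_of_nat:
  "padic_nth (of_nat k :: 'a :: {field, finite} padic_int) n = int k mod int CHAR('a) ^ n"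
  by (induction k)
     (simp_all add: zero_padic_int.rep_eq plus_padic_int.rep_eq one_padic_int.rep_eq mod_simps)

instance padic_int :: ("{field, finite}") ring_char_0
proof
  show "inj (of_nat :: nat \<Rightarrow> 'a padic_int)"
  proof (rule injI)
    fix k l :: nat
    assume eq: "(of_nat k :: 'a padic_int) = of_nat l"
    define n where "n = max k l"
    have "int CHAR('a) > 1"
      using prime_gt_1_int[OF prime_CHAR_finite_field[where 'a = 'a]] .
    hence "CHAR('a) > 1" by simp
    hence "n < CHAR('a) ^ n" by (intro power_gt_expt) simp
    hence "k < CHAR('a) ^ n" "l < CHAR('a) ^ n" by (auto simp: n_def)
    hence "int k < int CHAR('a) ^ n" "int l < int CHAR('a) ^ n"
      by (metis of_nat_less_iff of_nat_power)+
    moreover have "int k mod int CHAR('a) ^ n = int l mod int CHAR('a) ^ n"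
      using arg_cong[OF eq, of "\<lambda>x. padic_nth x n"] by (simp add: padic_nth_of_nat)
    ultimately show "k = l" by simp
  qed
qed

text \<open>Exact division, needed for binomial coefficients.\<close>

instantiation padic_int :: ("{field, finite}") semidom_divide
begin

definition divide_padic_int :: "'a padic_int \<Rightarrow> 'a padic_int \<Rightarrow> 'a padic_int" where
  "divide_padic_int x y = (if y \<noteq> 0 \<and> y dvd x then THE z. x = z * y else 0)"

instance
proof
  fix a b :: "'a padic_int"
  show "a * b div b = a" if "b \<noteq> 0"
    using that by (auto simp: divide_padic_int_def intro!: the_equality)
  show "a div 0 = 0" by (simp add: divide_padic_int_def)
qed

end

text \<open>
  This is \<open>y gchoose i\<close> written out: the library restricts parsing of \<open>gchoose\<close> to fields of characteristic 0.
  The quotient is exact: for natural numbers \<open>y\<close> clearly, and these are dense.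
\<close>

definition padic_binomial :: "'a :: {field, finite} padic_int \<Rightarrow> nat \<Rightarrow> 'a padic_int" where
  "padic_binomial y i = (\<Prod>k<i. y - of_nat k) div fact i"

text \<open>The topology of the inverse limit, i.e. the p-adic one.\<close>

instantiation padic_int :: ("{field, finite}") t2_space
begin

definition open_padic_int :: "'a padic_int set \<Rightarrow> bool" where
  "open_padic_int U \<longleftrightarrow>
     (\<forall>x\<in>U. \<exists>n. \<forall>y. padic_nth y n = padic_nth x n \<longrightarrow> y \<in> U)"

lemma open_padic_int_ball: "open {y :: 'a padic_int. padic_nth y n = padic_nth x n}"
  unfolding open_padic_int_def by (intro ballI exI[of _ n]) simp

instance
proof
  show "open (UNIV :: 'a padic_int set)" by (simp add: open_padic_int_def)
next
  fix S T :: "'a padic_int set"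
  assume S: "open S" and T: "open T"
  show "open (S \<inter> T)"
    unfolding open_padic_int_def
  proof
    fix x assume x: "x \<in> S \<inter> T"
    obtain m n where m: "\<forall>y. padic_nth y m = padic_nth x m \<longrightarrow> y \<in> S"
                 and n: "\<forall>y. padic_nth y n = padic_nth x n \<longrightarrow> y \<in> T"
      using S T x unfolding open_padic_int_def by blast
    have "y \<in> S \<inter> T" if "padic_nth y (max m n) = padic_nth x (max m n)" for y
      using m n that padic_nth_mod[of m "max m n"] padic_nth_mod[of n "max m n"]
      by (metis IntI max.cobounded1 max.cobounded2)
    thus "\<exists>k. \<forall>y. padic_nth y k = padic_nth x k \<longrightarrow> y \<in> S \<inter> T" by blast
  qed
next
  fix K :: "'a padic_int set set"
  assume "\<forall>S\<in>K. open S"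
  thus "open (\<Union>K)" unfolding open_padic_int_def by (meson UnionE UnionI)
next
  fix x y :: "'a padic_int"
  assume "x \<noteq> y"
  then obtain n where "padic_nth x n \<noteq> padic_nth y n" by (metis padic_int_eqI)
  thus "\<exists>U V. open U \<and> open V \<and> x \<in> U \<and> y \<in> V \<and> U \<inter> V = {}"
    by (intro exI[of _ "{z. padic_nth z n = padic_nth x n}"]
              exI[of _ "{z. padic_nth z n = padic_nth y n}"])
       (auto intro: open_padic_int_ball)
qed

end


section \<open>The group of digit permutations\<close>

text \<open>Here \<open>q = CARD('a)\<close>.\<close>

definition q_digits :: "'a :: {field, finite} padic_int \<Rightarrow> nat \<Rightarrow> nat" where
  "q_digits x = (THE c. (\<forall>i. c i < CARD('a)) \<and> (\<lambda>i. of_nat (c i) * of_nat CARD('a) ^ i) sums x)"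

definition digit_perm :: "(nat \<Rightarrow> nat) \<Rightarrow> 'a :: {field, finite} padic_int \<Rightarrow> 'a padic_int" where
  "digit_perm \<rho> x = (\<Sum>i. of_nat (q_digits x i) * of_nat CARD('a) ^ \<rho> i)"

definition S_q :: "('a :: {field, finite} padic_int \<Rightarrow> 'a padic_int) set" where
  "S_q = {digit_perm \<rho> |\<rho>. bij \<rho>}"


section \<open>The completion of an algebraic closure of the Laurent series field\<close>

text \<open>
  The field \<open>k\<^sub>\<infinity>\<close> is \<^typ>\<open>'a fls\<close>, the variable \<^const>\<open>fls_X\<close> being \<open>1/T\<close>.  The absolute value
  of \<open>x\<close> is \<open>dist x 0\<close>; the library's metric on \<^typ>\<open>'a fls\<close> is the \<open>1/T\<close>-adic one, normalised by
  \<open>\<bar>T\<bar> = 2\<close>.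

  The field \<open>'c\<close>, together with \<open>emb\<close>, is the completion of the algebraic closure of \<open>k\<^sub>\<infinity>\<close>:
  it is complete for a multiplicative absolute value that extends the one of \<open>k\<^sub>\<infinity>\<close>, and the
  algebraic closure is dense in it.  (The absolute value of a complete field extends uniquely to
  an algebraic closure, so this determines \<open>'c\<close> up to isometric isomorphism.)
\<close>

locale completed_alg_closure =
  fixes emb :: "'a :: {field, finite} fls alg_closure \<Rightarrow> 'c :: {field, complete_space}"
  assumes emb_1: "emb 1 = 1"
    and emb_add: "emb (a + b) = emb a + emb b"
    and emb_mult: "emb (a * b) = emb a * emb b"
    and dist_add_right: "\<And>x y z :: 'c. dist (x + z) (y + z) = dist x y"
    and dist_mult_0: "\<And>x y :: 'c. dist (x * y) 0 = dist x 0 * dist y 0"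
    and dist_emb: "dist (emb (to_ac f)) 0 = dist f 0"
    and dense_emb: "closure (range emb) = UNIV"


section \<open>The zeta function\<close>

definition one_unit :: "'a :: field fls \<Rightarrow> bool" where
  "one_unit u \<longleftrightarrow> dist u 1 < 1"

definition positive_uniformizer :: "'a :: field fls \<Rightarrow> bool" where
  "positive_uniformizer \<pi> \<longleftrightarrow> (\<exists>u. one_unit u \<and> \<pi> = fls_X * u)"

definition poly_to_fls :: "'a :: field poly \<Rightarrow> 'a fls" where
  "poly_to_fls f = poly (map_poly fls_const f) fls_X_inv"

definition one_unit_part :: "'a :: field fls \<Rightarrow> 'a poly \<Rightarrow> 'a fls" where
  "one_unit_part \<pi> f = \<pi> ^ Polynomial.degree f * poly_to_fls f"

text \<open>
  The binomial series; its coefficients, binomial coefficients in the p-adic integers, act on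
  \<open>k\<^sub>\<infinity>\<close> through their residues modulo \<open>p\<close>.
\<close>

definition one_unit_powr ::
  "'a :: {field, finite} fls \<Rightarrow> 'a padic_int \<Rightarrow> 'a fls" where
  "one_unit_powr u y = (\<Sum>i. of_int (padic_nth (padic_binomial y i) 1) * (u - 1) ^ i)"

definition zeta_A ::
  "('a :: {field, finite} fls alg_closure \<Rightarrow> 'c :: {field, complete_space}) \<Rightarrow> 'a fls \<Rightarrow>
     'c \<Rightarrow> 'a padic_int \<Rightarrow> 'c" where
  "zeta_A emb \<pi> x y =
     (\<Sum>e. inverse x ^ e *
        emb (to_ac (\<Sum>f | Polynomial.lead_coeff f = 1 \<and> Polynomial.degree f = e.
                       one_unit_powr (one_unit_part \<pi> f) (- y))))"

text \<open>
  For a function that is analytic at \<open>x\<^sub>0\<close> and not identically zero nearby: the index of the first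
  nonzero coefficient of its power series expansion at \<open>x\<^sub>0\<close>.
\<close>

definition has_zero_order :: "('c :: {field, metric_space} \<Rightarrow> 'c) \<Rightarrow> 'c \<Rightarrow> nat \<Rightarrow> bool" where
  "has_zero_order g x\<^sub>0 n \<longleftrightarrow>
     (\<exists>a. (\<exists>r>0. \<forall>x\<in>ball x\<^sub>0 r. (\<lambda>k. a k * (x - x\<^sub>0) ^ k) sums g x) \<and>
          (\<forall>k<n. a k = 0) \<and> a n \<noteq> 0)"

definition zero_order :: "('c :: {field, metric_space} \<Rightarrow> 'c) \<Rightarrow> 'c \<Rightarrow> nat" where
  "zero_order g x\<^sub>0 = (THE n. has_zero_order g x\<^sub>0 n)"

definition zeta_order_at_neg ::
  "('a :: {field, finite} fls alg_closure \<Rightarrow> 'c :: {field, complete_space}) \<Rightarrow> 'a fls \<Rightarrow>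
     nat \<Rightarrow> nat" where
  "zeta_order_at_neg emb \<pi> j =
     zero_order (\<lambda>x. zeta_A emb \<pi> x (- of_nat j)) (emb (to_ac (\<pi> ^ j)))"

end

theory Submission
  imports Defs "HOL-Algebra.Sylow"
begin

text \<open>
  Let \<open>q\<close> be the number of elements of the finite field and \<open>p\<close> its characteristic. The order of
  vanishing at \<open>-j\<close> is computed outright: it is \<open>1\<close> if \<open>q - 1\<close> divides \<open>j\<close> and \<open>0\<close>
  otherwise (\<open>zeta_order_at_neg_eq\<close>). A permutation of the base-\<open>q\<close> digits of \<open>j\<close> keeps the sum of the
  digits, which is congruent to \<open>j\<close> modulo \<open>q - 1\<close>; so it keeps the order of vanishing
  (\<open>digit_perm_of_nat\<close>).

  The computation goes as follows. Write \<open>S\<^sub>e(j)\<close> for the sum of \<open>f ^ j\<close> over the monic polynomials \<open>f\<close> of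
  degree \<open>e\<close>. In terms of \<open>u = \<pi> ^ j / x\<close>, the function \<open>\<zeta>(x, -j)\<close> is \<open>Z\<^sub>j(u) = (\<Sum>e. S\<^sub>e(j) * u ^ e)\<close>
  (\<open>zeta_A_at_neg\<close>), and the point \<open>-j\<close> is \<open>u = 1\<close>. Every monic \<open>f\<close> of degree \<open>e + 1\<close> is \<open>c + T h\<close> with a
  constant \<open>c\<close> and a monic \<open>h\<close> of degree \<open>e\<close>. Expanding \<open>(c + T h) ^ j\<close> and summing over \<open>c\<close> gives
  \<open>monic_power_sum_Suc\<close>, where the power sums \<open>(\<Sum>c. c ^ m)\<close> over the finite field are \<open>-1\<close> if
  \<open>m > 0\<close> is divisible by \<open>q - 1\<close>, and \<open>0\<close> otherwise. Hence \<open>Z\<^sub>j\<close> is a polynomial and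

    \<open>Z\<^sub>j(u) = 1 - u * (\<Sum>i. (j choose i) * T ^ i * Z\<^sub>i(u))\<close>,

  with \<open>i\<close> ranging over the \<open>i < j\<close> congruent to \<open>j\<close> modulo \<open>q - 1\<close>. Three consequences follow at
  \<open>u = 1\<close>. If \<open>q - 1\<close> does not divide \<open>j\<close>, then \<open>Z\<^sub>j(1) \<equiv> 1\<close> modulo \<open>T\<close>, as the index \<open>i = 0\<close> does not
  occur. If it does divide \<open>j > 0\<close>, then \<open>Z\<^sub>j(1) = 0\<close> by induction, as the index \<open>i = 0\<close> contributes
  \<open>-1\<close>; and \<open>Z\<^sub>j'(1) \<equiv> -1\<close> modulo \<open>T\<close>, so this zero is simple.

  It remains to pass from \<open>Z\<^sub>j(u)\<close> to the order of vanishing in \<open>x\<close>, which is defined through power series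
  expansions over a field that is neither real nor complex. The order is unique because the leading
  term dominates near the point (\<open>has_zero_order_le\<close>), and polynomials in \<open>x\<^sub>0 / x\<close> have an explicit expansion
  at \<open>x\<^sub>0\<close> whose first coefficients are given by the value and the derivative at \<open>u = 1\<close>
  (\<open>expansion_poly_quotient\<close>).
\<close>

section \<open>Power sums and the cardinality of a finite field\<close>

lemma of_nat_CARD_eq_0: "of_nat CARD('a) = (0 :: 'a :: {field, finite})"
proof -
  have "(\<Sum>c\<in>UNIV. c + 1) = (\<Sum>c\<in>UNIV. c :: 'a)"
    by (rule sum.reindex_bij_witness[of _ "\<lambda>c. c - 1" "\<lambda>c. c + 1"]) auto
  then show ?thesis by (simp add: sum.distrib)
qed

lemma CARD_ge_2: "2 \<le> CARD('a :: {field, finite})"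
proof -
  have "card {0 :: 'a, 1} \<le> CARD('a)" by (intro card_mono) auto
  then show ?thesis by simp
qed

lemma power_CARD_minus_1_eq_1:
  fixes c :: "'a :: {field, finite}"
  assumes "c \<noteq> 0"
  shows "c ^ (CARD('a) - 1) = 1"
proof -
  have "(\<Prod>y\<in>UNIV - {0}. c * y) = (\<Prod>y\<in>UNIV - {0}. y)"
    by (rule prod.reindex_bij_witness[of _ "\<lambda>y. y / c" "\<lambda>y. c * y"]) (use assms in auto)
  then have "c ^ (CARD('a) - 1) * (\<Prod>y\<in>UNIV - {0 :: 'a}. y) = 1 * (\<Prod>y\<in>UNIV - {0 :: 'a}. y)"
    by (simp add: prod.distrib)
  moreover have "(\<Prod>y\<in>UNIV - {0 :: 'a}. y) \<noteq> 0"
    by (subst prod_zero_iff) auto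
  ultimately show ?thesis by (metis mult_right_cancel)
qed

lemma power_mod_CARD_minus_1:
  fixes c :: "'a :: {field, finite}"
  assumes "c \<noteq> 0"
  shows "c ^ m = c ^ (m mod (CARD('a) - 1))"
proof -
  have "c ^ m = (c ^ (CARD('a) - 1)) ^ (m div (CARD('a) - 1)) * c ^ (m mod (CARD('a) - 1))"
    by (simp flip: power_mult power_add)
  then show ?thesis using power_CARD_minus_1_eq_1[OF assms] by simp
qed

text \<open>
  A nonzero \<open>c\<close> satisfies \<open>c ^ m = c ^ r\<close> for \<open>r = m mod (q - 1)\<close>, and the polynomial
  \<open>X ^ r - 1\<close> with \<open>0 < r < q - 1\<close> has fewer roots than there are nonzero elements.
\<close>

lemma ex_power_neq_1:
  assumes "\<not> (CARD('a) - 1) dvd m"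
  obtains c :: "'a :: {field, finite}" where "c \<noteq> 0" "c ^ m \<noteq> 1"
proof -
  define r where "r = m mod (CARD('a) - 1)"
  have r: "0 < r" "r < CARD('a) - 1"
    using assms CARD_ge_2[where 'a = 'a] by (auto simp: r_def mod_greater_zero_iff_not_dvd)
  define P :: "'a poly" where "P = Polynomial.monom 1 r - 1"
  have "Polynomial.coeff P r = 1" using r by (simp add: P_def)
  then have "P \<noteq> 0" by auto
  have "Polynomial.degree P \<le> r"
    unfolding P_def by (intro degree_diff_le) (auto simp: degree_monom_le)
  then have "card {c. poly P c = 0} \<le> r"
    using card_poly_roots_bound[OF \<open>P \<noteq> 0\<close>] by linarith
  also have "\<dots> < card (UNIV - {0 :: 'a})" using r by simp
  finally have "\<not> UNIV - {0} \<subseteq> {c. poly P c = 0}"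
    using card_mono[of "{c. poly P c = 0}" "UNIV - {0}"] by auto
  then obtain c :: 'a where "c \<noteq> 0" "c ^ r \<noteq> 1" by (auto simp: P_def poly_monom)
  with that[of c] show thesis using power_mod_CARD_minus_1[of c m] by (simp add: r_def)
qed

text \<open>
  If \<open>q - 1\<close> does not divide \<open>m\<close>, multiplying the summation variable by some \<open>g\<close> with
  \<open>g ^ m \<noteq> 1\<close> rescales the sum by \<open>g ^ m\<close>, so the sum vanishes. Otherwise all nonzero \<open>c\<close>
  contribute \<open>1\<close>, and \<open>q - 1 = -1\<close> in the field. For \<open>m = 0\<close> the element \<open>0\<close> contributes a
  further \<open>1\<close>.
\<close>

lemma power_sum_finite_field:
  "(\<Sum>c\<in>UNIV. c ^ m) = (if 0 < m \<and> (CARD('a) - 1) dvd m then -1 else 0 :: 'a :: {field, finite})"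
proof (cases "(CARD('a) - 1) dvd m")
  case True
  show ?thesis
  proof (cases "m = 0")
    case True
    then show ?thesis by (simp add: of_nat_CARD_eq_0)
  next
    case False
    have "(\<Sum>c\<in>UNIV. c ^ m) = (\<Sum>c\<in>UNIV - {0 :: 'a}. c ^ m)"
      by (rule sum.mono_neutral_right) (use False in auto)
    also have "\<dots> = (\<Sum>c\<in>UNIV - {0 :: 'a}. 1)"
      by (rule sum.cong) (use True power_mod_CARD_minus_1[of "_ :: 'a" m] in auto)
    also have "\<dots> = -1"
      using CARD_ge_2[where 'a = 'a] by (simp add: of_nat_diff of_nat_CARD_eq_0)
    finally show ?thesis using True False by simp
  qed
next
  case False
  obtain g :: 'a where g: "g \<noteq> 0" "g ^ m \<noteq> 1" using ex_power_neq_1[OF False] .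
  have "(\<Sum>c\<in>UNIV. (g * c) ^ m) = (\<Sum>c\<in>UNIV. c ^ m)"
    by (rule sum.reindex_bij_witness[of _ "\<lambda>c. c / g" "\<lambda>c. g * c"]) (use g in auto)
  then have "(g ^ m - 1) * (\<Sum>c\<in>UNIV. c ^ m) = 0"
    by (simp add: power_mult_distrib left_diff_distrib flip: sum_distrib_left)
  then show ?thesis using False g by auto
qed

definition additive_group :: "'a :: ab_group_add monoid" where
  "additive_group = \<lparr>carrier = UNIV, monoid.mult = (+), one = 0\<rparr>"

lemma group_additive_group: "group (additive_group :: 'a :: ab_group_add monoid)"
proof (rule groupI)
  fix x :: 'a
  show "\<exists>y\<in>carrier additive_group. y \<otimes>\<^bsub>additive_group\<^esub> x = \<one>\<^bsub>additive_group\<^esub>"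
    by (intro bexI[of _ "- x"]) (auto simp: additive_group_def)
qed (auto simp: additive_group_def add.assoc)

lemma pow_additive_group: "x [^]\<^bsub>additive_group\<^esub> n = of_nat n * (x :: 'a :: comm_ring_1)"
proof (induction n)
  case 0
  show ?case by (simp add: additive_group_def nat_pow_def)
next
  case (Suc n)
  have "x [^]\<^bsub>additive_group\<^esub> Suc n = x [^]\<^bsub>additive_group\<^esub> n + x"
    by (simp add: additive_group_def nat_pow_def)
  with Suc show ?case by (simp add: algebra_simps)
qed

lemma prime_CHAR_nat: "normalization_semidom_class.prime CHAR('a :: {field, finite})"
  using prime_CHAR_finite_field[where 'a = 'a] by simp

text \<open>
  A subgroup of order \<open>l\<close> of the additive group, which Sylow's theorem provides, contains a nonzero
  element \<open>x\<close> with \<open>l * x = 0\<close>; hence \<open>l = 0\<close> in the field.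
\<close>

lemma prime_dvd_CARD_imp_eq_CHAR:
  assumes "normalization_semidom_class.prime l" "l dvd CARD('a :: {field, finite})"
  shows "l = CHAR('a)"
proof (rule ccontr)
  assume neq: "l \<noteq> CHAR('a)"
  interpret G: group "additive_group :: 'a monoid" by (rule group_additive_group)
  have ord: "order (additive_group :: 'a monoid) = CARD('a)"
    by (simp add: order_def additive_group_def)
  obtain m where m: "CARD('a) = l ^ 1 * m" using assms(2) by auto
  have "\<exists>H. subgroup H (additive_group :: 'a monoid) \<and> card H = l ^ 1"
  proof (rule sylow_thm)
    show "Factorial_Ring.prime l" by fact
    show "order (additive_group :: 'a monoid) = l ^ 1 * m" using ord m by simp
  qed (auto simp: additive_group_def group_additive_group[unfolded additive_group_def])
  then obtain H where H: "subgroup H (additive_group :: 'a monoid)" "card H = l" by auto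
  have "l > 1" using assms(1) by (rule prime_gt_1_nat)
  obtain x where x: "x \<in> H" "x \<noteq> 0"
  proof -
    have "\<not> H \<subseteq> {0}" using H(2) \<open>l > 1\<close> card_mono[of "{0}" H] by auto
    then show thesis using that by blast
  qed
  interpret K: group "additive_group\<lparr>carrier := H\<rparr> :: 'a monoid"
    using H(1) by (rule subgroup.subgroup_is_group) (rule group_additive_group)
  have "x [^]\<^bsub>additive_group\<lparr>carrier := H\<rparr>\<^esub> order (additive_group\<lparr>carrier := H\<rparr> :: 'a monoid)
        = \<one>\<^bsub>additive_group\<lparr>carrier := H\<rparr>\<^esub>"
    by (rule K.pow_order_eq_1) (simp add: x)
  then have "x [^]\<^bsub>additive_group\<^esub> l = (0 :: 'a)"
    using H(2) by (simp add: order_def nat_pow_def additive_group_def)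
  then have "of_nat l * x = 0" by (simp add: pow_additive_group)
  then have "of_nat l = (0 :: 'a)" using x(2) by simp
  then have "CHAR('a) dvd l" by (simp add: of_nat_eq_0_iff_char_dvd)
  then show False using assms(1) neq prime_CHAR_nat[where 'a = 'a] primes_dvd_imp_eq by metis
qed

text \<open>
  This links the two bases in play: \<open>p\<close>-adic integers are given by residues modulo powers of \<open>p\<close>,
  whereas their digits are taken to the base \<open>q\<close>.
\<close>

lemma CARD_eq_CHAR_power:
  obtains r where "CARD('a :: {field, finite}) = CHAR('a) ^ r"
proof -
  define p where "p = CHAR('a)"
  have p: "normalization_semidom_class.prime p" unfolding p_def by (rule prime_CHAR_nat)
  have "CARD('a) \<noteq> 0" "\<not> p dvd 1" using p by auto
  then obtain k where k: "CARD('a) = p ^ multiplicity p CARD('a) * k" "\<not> p dvd k"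
    using multiplicity_decompose'[of "CARD('a)" p] by (auto simp: normalization_semidom_class.prime_def)
  have "k = 1"
  proof (rule ccontr)
    assume "k \<noteq> 1"
    then obtain l where l: "normalization_semidom_class.prime l" "l dvd k"
      using prime_factor_nat by blast
    then have "l dvd CARD('a)" using k(1) by (metis dvd_mult)
    then show False using l k(2) prime_dvd_CARD_imp_eq_CHAR[where 'a = 'a and l = l] by (simp add: p_def)
  qed
  then have "CARD('a) = p ^ multiplicity p CARD('a)" using k(1) by simp
  with that show thesis unfolding p_def by blast
qed

section \<open>Digit permutations of natural numbers\<close>

lemma digit_sum_less_power:
  fixes q :: nat
  assumes c: "\<And>i. c i < q"
  shows "(\<Sum>i<n. c i * q ^ i) < q ^ n"
proof (induction n)
  case (Suc n)
  have "(\<Sum>i<Suc n. c i * q ^ i) < q ^ n + c n * q ^ n" using Suc by simp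
  also have "\<dots> = (1 + c n) * q ^ n" by simp
  also have "\<dots> \<le> q * q ^ n" using c[of n] by (intro mult_right_mono) auto
  finally show ?case by simp
qed simp

lemma digit_expansion_nat:
  fixes q :: nat
  shows "j = (\<Sum>i<n. (j div q ^ i mod q) * q ^ i) + j div q ^ n * q ^ n"
proof (induction n)
  case (Suc n)
  have "j div q ^ n * q ^ n = (j div q ^ n mod q + j div q ^ Suc n * q) * q ^ n"
    by (simp only: power_Suc2 div_mult2_eq mod_div_mult_eq)
  then show ?case using Suc by (simp add: algebra_simps)
qed simp

text \<open>
  From the index \<open>n\<close> on, the terms of the series are divisible by \<open>q ^ n = p ^ (r * n)\<close>, so the
  residue of \<open>x\<close> modulo \<open>q ^ n\<close> is the \<open>n\<close>-th partial sum itself. Applied to \<open>n\<close> and \<open>n + 1\<close>, this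
  recovers the \<open>n\<close>-th digit from \<open>x\<close>.
\<close>

lemma sums_digits_imp_nth:
  fixes x :: "'a :: {field, finite} padic_int"
  assumes q: "CARD('a) = CHAR('a) ^ r"
    and c: "\<And>i. c i < CARD('a)"
    and x: "(\<lambda>i. of_nat (c i) * of_nat CARD('a) ^ i) sums x"
  shows "padic_nth x (r * n) = int (\<Sum>i<n. c i * CARD('a) ^ i)"
proof -
  define q where "q = CARD('a)"
  have qn: "int CHAR('a) ^ (r * n) = int (q ^ n)" using q by (simp add: q_def power_mult)
  have "\<forall>\<^sub>F N in sequentially.
          padic_nth (\<Sum>i<N. of_nat (c i) * of_nat q ^ i :: 'a padic_int) (r * n) = padic_nth x (r * n)"
    using topological_tendstoD[OF x[unfolded sums_def] open_padic_int_ball[of "r * n" x]]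
    by (simp add: q_def)
  then obtain M where M: "\<And>N. N \<ge> M \<Longrightarrow>
      padic_nth (\<Sum>i<N. of_nat (c i) * of_nat q ^ i :: 'a padic_int) (r * n) = padic_nth x (r * n)"
    by (auto simp: eventually_sequentially)
  define N where "N = max M n"
  have N: "N \<ge> n" "padic_nth (\<Sum>i<N. of_nat (c i) * of_nat q ^ i :: 'a padic_int) (r * n) = padic_nth x (r * n)"
    using M[of N] by (simp_all add: N_def)
  have "(\<Sum>i<N. of_nat (c i) * of_nat q ^ i :: 'a padic_int) = of_nat (\<Sum>i<N. c i * q ^ i)" by simp
  with N(2) have "padic_nth x (r * n) = int ((\<Sum>i<N. c i * q ^ i) mod q ^ n)"
    by (simp only: padic_nth_of_nat qn zmod_int)
  also have "(\<Sum>i<N. c i * q ^ i) = (\<Sum>i<n. c i * q ^ i) + (\<Sum>i=n..<N. c i * q ^ i)"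
    using N(1) by (simp add: sum.atLeastLessThan_concat lessThan_atLeast0)
  also have "q ^ n dvd (\<Sum>i=n..<N. c i * q ^ i)"
    by (intro dvd_sum) (auto simp: le_imp_power_dvd)
  then have "((\<Sum>i<n. c i * q ^ i) + (\<Sum>i=n..<N. c i * q ^ i)) mod q ^ n = (\<Sum>i<n. c i * q ^ i) mod q ^ n"
    using mod_add_right_eq[of "\<Sum>i<n. c i * q ^ i" "\<Sum>i=n..<N. c i * q ^ i" "q ^ n"]
    by (simp add: dvd_eq_mod_eq_0)
  also have "\<dots> = (\<Sum>i<n. c i * q ^ i)"
    using digit_sum_less_power[of c q n] c by (simp add: q_def)
  finally show ?thesis by (simp only: q_def)
qed

lemma q_digits_eqI:
  fixes x :: "'a :: {field, finite} padic_int"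
  assumes c: "\<And>i. c i < CARD('a)"
    and x: "(\<lambda>i. of_nat (c i) * of_nat CARD('a) ^ i) sums x"
  shows "q_digits x = c"
  unfolding q_digits_def
proof (rule the_equality)
  show "(\<forall>i. c i < CARD('a)) \<and> (\<lambda>i. of_nat (c i) * of_nat CARD('a) ^ i) sums x"
    using c x by blast
next
  fix d
  assume d: "(\<forall>i. d i < CARD('a)) \<and> (\<lambda>i. of_nat (d i) * of_nat CARD('a) ^ i) sums x"
  obtain r where q: "CARD('a) = CHAR('a) ^ r" by (rule CARD_eq_CHAR_power)
  show "d = c"
  proof
    fix n
    have "int (\<Sum>i<m. d i * CARD('a) ^ i) = int (\<Sum>i<m. c i * CARD('a) ^ i)" for m
      using sums_digits_imp_nth[OF q _ x, of m] sums_digits_imp_nth[OF q, of d x m] c d by simp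
    then have eq: "(\<Sum>i<m. d i * CARD('a) ^ i) = (\<Sum>i<m. c i * CARD('a) ^ i)" for m
      by (simp only: of_nat_eq_iff)
    show "d n = c n" using eq[of n] eq[of "Suc n"] by simp
  qed
qed

lemma less_CARD_power:
  assumes "j \<le> i"
  shows "j < CARD('a :: {field, finite}) ^ i"
  using le_less_trans[OF assms less_le_trans[OF less_exp power_mono[of 2 "CARD('a)" i]]] CARD_ge_2[where 'a = 'a]
  by simp

lemma q_digits_of_nat:
  "q_digits (of_nat j :: 'a :: {field, finite} padic_int) = (\<lambda>i. j div CARD('a) ^ i mod CARD('a))"
proof (rule q_digits_eqI)
  fix i show "j div CARD('a) ^ i mod CARD('a) < CARD('a)" by simp
next
  define q where "q = CARD('a)"
  have small: "j < q ^ i" if "i \<ge> j" for i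
    unfolding q_def using that by (rule less_CARD_power)
  have "(\<lambda>i. of_nat (j div q ^ i mod q) * of_nat q ^ i) sums
          (\<Sum>i<j. of_nat (j div q ^ i mod q) * of_nat q ^ i :: 'a padic_int)"
    by (rule sums_finite) (auto simp: small not_less)
  also have "(\<Sum>i<j. of_nat (j div q ^ i mod q) * of_nat q ^ i :: 'a padic_int) =
             of_nat (\<Sum>i<j. (j div q ^ i mod q) * q ^ i)" by simp
  also have "(\<Sum>i<j. (j div q ^ i mod q) * q ^ i) = j"
    using digit_expansion_nat[of j q j] small[of j] by simp
  finally show "(\<lambda>i. of_nat (j div CARD('a) ^ i mod CARD('a)) * of_nat CARD('a) ^ i)
                  sums (of_nat j :: 'a padic_int)"
    by (simp only: q_def)
qed

text \<open>
  As \<open>q \<equiv> 1\<close> modulo \<open>q - 1\<close>, the exponents do not affect the residue; this is what makes the residue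
  modulo \<open>q - 1\<close> invariant under permutations of the digits.
\<close>

lemma cong_minus_1_digit_sum:
  fixes q :: nat
  assumes "q \<ge> 1"
  shows "(\<Sum>i<n. c i * q ^ e i) mod (q - 1) = (\<Sum>i<n. c i) mod (q - 1)"
proof -
  have "q mod (q - 1) = (1 + (q - 1)) mod (q - 1)" using assms by simp
  also have "\<dots> = 1 mod (q - 1)" by (rule mod_add_self2)
  finally have "q ^ k mod (q - 1) = 1 mod (q - 1)" for k
    using power_mod[of q "q - 1" k] power_mod[of 1 "q - 1" k] by simp
  then have *: "c i * q ^ k mod (q - 1) = c i mod (q - 1)" for i k
    using mod_mult_right_eq[of "c i" "q ^ k" "q - 1"] mod_mult_right_eq[of "c i" 1 "q - 1"] by simp
  have "(\<Sum>i<n. c i * q ^ e i) mod (q - 1) = (\<Sum>i<n. c i * q ^ e i mod (q - 1)) mod (q - 1)"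
    by (rule mod_sum_eq[symmetric])
  also have "\<dots> = (\<Sum>i<n. c i mod (q - 1)) mod (q - 1)" by (simp only: *)
  also have "\<dots> = (\<Sum>i<n. c i) mod (q - 1)" by (rule mod_sum_eq)
  finally show ?thesis .
qed

lemma digit_perm_of_nat:
  assumes "j > 0"
  obtains j' where "j' > 0" "digit_perm \<rho> (of_nat j :: 'a :: {field, finite} padic_int) = of_nat j'"
    "j' mod (CARD('a) - 1) = j mod (CARD('a) - 1)"
proof -
  define q where "q = CARD('a)"
  have q2: "q \<ge> 2" unfolding q_def by (rule CARD_ge_2)
  define c where "c i = j div q ^ i mod q" for i
  define j' where "j' = (\<Sum>i<j. c i * q ^ \<rho> i)"
  have small: "j < q ^ i" if "i \<ge> j" for i
    unfolding q_def using that by (rule less_CARD_power)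
  have j: "j = (\<Sum>i<j. c i * q ^ i)"
    using digit_expansion_nat[of j q j] small[of j] by (simp add: c_def)
  have "digit_perm \<rho> (of_nat j :: 'a padic_int) = (\<Sum>i. of_nat (c i) * of_nat q ^ \<rho> i)"
    unfolding digit_perm_def q_digits_of_nat by (simp only: c_def q_def)
  also have "\<dots> = (\<Sum>i<j. of_nat (c i) * of_nat q ^ \<rho> i)"
    by (rule suminf_finite) (auto simp: small not_less c_def)
  also have "\<dots> = of_nat j'" by (simp add: j'_def)
  finally have 1: "digit_perm \<rho> (of_nat j :: 'a padic_int) = of_nat j'" .
  have "j' mod (q - 1) = (\<Sum>i<j. c i) mod (q - 1)"
    unfolding j'_def by (rule cong_minus_1_digit_sum) (use q2 in simp)
  also have "\<dots> = (\<Sum>i<j. c i * q ^ i) mod (q - 1)"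
    by (rule cong_minus_1_digit_sum[symmetric]) (use q2 in simp)
  also have "\<dots> = j mod (q - 1)" using j by simp
  finally have 2: "j' mod (q - 1) = j mod (q - 1)" .
  have "\<exists>i<j. c i \<noteq> 0"
  proof (rule ccontr)
    assume "\<not> (\<exists>i<j. c i \<noteq> 0)"
    then have "(\<Sum>i<j. c i * q ^ i) = 0" by simp
    with j \<open>j > 0\<close> show False by simp
  qed
  then have "j' > 0" using q2 by (auto simp: j'_def intro!: sum_pos2)
  with that 1 2 show thesis by (simp add: q_def)
qed

section \<open>Power sums of monic polynomials\<close>

definition monic_polys :: "nat \<Rightarrow> 'a :: comm_semiring_1 poly set" where
  "monic_polys e = {f. Polynomial.lead_coeff f = 1 \<and> Polynomial.degree f = e}"

definition monic_power_sum :: "nat \<Rightarrow> nat \<Rightarrow> 'a :: {field, finite} poly" where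
  "monic_power_sum e j = (\<Sum>f\<in>monic_polys e. f ^ j)"

lemma monic_polys_0: "monic_polys 0 = {1 :: 'a :: field poly}"
proof -
  have "f = 1" if "Polynomial.lead_coeff f = 1" "Polynomial.degree f = 0" for f :: "'a poly"
    using that by (cases f) (auto simp: one_pCons split: if_splits)
  then show ?thesis by (auto simp: monic_polys_def)
qed

text \<open>
  The decomposition \<open>f = c + T h\<close> of a monic polynomial of positive degree.
\<close>

lemma bij_betw_monic_polys_Suc:
  "bij_betw (\<lambda>(c, h). pCons c h) (UNIV \<times> monic_polys e) (monic_polys (Suc e) :: 'a :: field poly set)"
proof (rule bij_betwI')
  fix f :: "'a poly"
  assume f: "f \<in> monic_polys (Suc e)"
  obtain c h where "f = pCons c h" by (cases f)
  with f show "\<exists>x\<in>UNIV \<times> monic_polys e. f = (case x of (c, h) \<Rightarrow> pCons c h)"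
    by (intro bexI[of _ "(c, h)"]) (auto simp: monic_polys_def split: if_splits)
next
  fix x :: "'a \<times> 'a poly"
  assume "x \<in> UNIV \<times> monic_polys e"
  then obtain c h where x: "x = (c, h)" and h: "Polynomial.lead_coeff h = 1" "Polynomial.degree h = e"
    by (auto simp: monic_polys_def)
  have "h \<noteq> 0" using h(1) by auto
  then show "(case x of (c, h) \<Rightarrow> pCons c h) \<in> monic_polys (Suc e)"
    using h by (simp add: x monic_polys_def)
qed (simp add: case_prod_unfold prod_eq_iff)

lemma monic_power_sum_0_left: "monic_power_sum 0 j = 1"
  by (simp add: monic_power_sum_def monic_polys_0)

text \<open>
  The factor of \<open>h ^ i\<close> in the binomial expansion of \<open>(c + T h) ^ j\<close>, summed over the constants \<open>c\<close>.
\<close>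

definition recursion_coeff :: "nat \<Rightarrow> nat \<Rightarrow> 'a :: {field, finite} poly" where
  "recursion_coeff j i = of_nat (j choose i) * [:\<Sum>c\<in>UNIV. c ^ (j - i):] * [:0, 1:] ^ i"

text \<open>
  Sum the binomial expansion of \<open>(c + T h) ^ j\<close> over \<open>c\<close> and \<open>h\<close>. The term \<open>i = j\<close> drops out because
  \<open>q = 0\<close> in the field, so the recursion strictly lowers the exponent as well as the degree.
\<close>

lemma monic_power_sum_Suc:
  "monic_power_sum (Suc e) j = (\<Sum>i<j. recursion_coeff j i * (monic_power_sum e i :: 'a :: {field, finite} poly))"
proof -
  have "monic_power_sum (Suc e) j = (\<Sum>(c, h)\<in>UNIV \<times> monic_polys e. pCons c h ^ j :: 'a poly)"
    unfolding monic_power_sum_def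
    by (subst sum.reindex_bij_betw[OF bij_betw_monic_polys_Suc, symmetric]) (simp add: case_prod_unfold)
  also have "\<dots> = (\<Sum>(c, h)\<in>UNIV \<times> monic_polys e.
                    \<Sum>i\<le>j. of_nat (j choose i) * [:c ^ (j - i):] * [:0, 1:] ^ i * h ^ i)"
  proof (rule sum.cong[OF refl], clarify)
    fix c :: 'a and h :: "'a poly"
    have "pCons c h ^ j = ([:0, 1:] * h + [:c:]) ^ j" by simp
    also have "\<dots> = (\<Sum>i\<le>j. of_nat (j choose i) * [:c ^ (j - i):] * [:0, 1:] ^ i * h ^ i)"
      unfolding binomial_ring
      by (intro sum.cong) (simp_all add: power_mult_distrib mult_ac poly_const_pow del: mult_pCons_left mult_pCons_right)
    finally show "pCons c h ^ j = \<dots>" .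
  qed
  also have "\<dots> = (\<Sum>c\<in>UNIV. \<Sum>h\<in>monic_polys e.
                    \<Sum>i\<le>j. of_nat (j choose i) * [:c ^ (j - i):] * [:0, 1:] ^ i * h ^ i)"
    by (rule sum.cartesian_product[symmetric])
  also have "\<dots> = (\<Sum>c\<in>UNIV. \<Sum>i\<le>j. of_nat (j choose i) * [:c ^ (j - i):] * [:0, 1:] ^ i * monic_power_sum e i)"
    unfolding monic_power_sum_def sum_distrib_left by (intro sum.cong refl sum.swap)
  also have "\<dots> = (\<Sum>i\<le>j. \<Sum>c\<in>UNIV. of_nat (j choose i) * [:c ^ (j - i):] * [:0, 1:] ^ i * monic_power_sum e i)"
    by (rule sum.swap)
  also have "\<dots> = (\<Sum>i\<le>j. recursion_coeff j i * monic_power_sum e i)"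
  proof (rule sum.cong[OF refl])
    fix i
    have "[:\<Sum>c\<in>UNIV. c ^ (j - i):] = (\<Sum>c\<in>UNIV. [:c ^ (j - i):] :: 'a poly)"
      by (rule sum_to_poly[symmetric])
    then show "(\<Sum>c\<in>UNIV. of_nat (j choose i) * [:c ^ (j - i):] * [:0, 1:] ^ i * monic_power_sum e i)
        = recursion_coeff j i * (monic_power_sum e i :: 'a poly)"
      unfolding recursion_coeff_def by (simp only: sum_distrib_left sum_distrib_right)
  qed
  also have "\<dots> = (\<Sum>i<j. recursion_coeff j i * monic_power_sum e i)"
    by (simp add: lessThan_Suc_atMost[symmetric] recursion_coeff_def power_sum_finite_field)
  finally show ?thesis .
qed

text \<open>
  Each step of the recursion lowers the exponent, and for the exponent \<open>0\<close> it is an empty sum. So only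
  finitely many degrees contribute at a negative integer.
\<close>

lemma monic_power_sum_eq_0: "j < e \<Longrightarrow> monic_power_sum e j = 0"
proof (induction e arbitrary: j)
  case (Suc e)
  show ?case unfolding monic_power_sum_Suc by (rule sum.neutral) (use Suc in auto)
qed simp

text \<open>
  The value at \<open>u = 1\<close> of the polynomial \<open>Z\<^sub>j(u) = (\<Sum>e. monic_power_sum e j * u ^ e)\<close>, and
  below the value of its derivative there; the coefficients of \<open>Z\<^sub>j\<close> with \<open>e > j\<close> are zero.
\<close>

definition zeta_value :: "nat \<Rightarrow> 'a :: {field, finite} poly" where
  "zeta_value j = (\<Sum>e\<le>j. monic_power_sum e j)"

definition zeta_deriv :: "nat \<Rightarrow> 'a :: {field, finite} poly" where
  "zeta_deriv j = (\<Sum>e\<le>j. of_nat e * monic_power_sum e j)"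

lemma zeta_value_extend: "j \<le> n \<Longrightarrow> zeta_value j = (\<Sum>e\<le>n. monic_power_sum e j)"
  unfolding zeta_value_def by (rule sum.mono_neutral_left) (auto simp: monic_power_sum_eq_0)

lemma zeta_deriv_extend: "j \<le> n \<Longrightarrow> zeta_deriv j = (\<Sum>e\<le>n. of_nat e * monic_power_sum e j)"
  unfolding zeta_deriv_def by (rule sum.mono_neutral_left) (auto simp: monic_power_sum_eq_0)

text \<open>
  The recursion for the power sums reads \<open>Z\<^sub>j(u) = 1 + u * (\<Sum>i<j. recursion_coeff j i * Z\<^sub>i(u))\<close>.
  This is its value at \<open>u = 1\<close>, and the next lemma is its derivative there.
\<close>

lemma zeta_value_rec: "zeta_value j = 1 + (\<Sum>i<j. recursion_coeff j i * zeta_value i)"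
proof -
  have "zeta_value j = (\<Sum>e\<le>Suc j. monic_power_sum e j)"
    by (rule zeta_value_extend) simp
  also have "\<dots> = 1 + (\<Sum>e\<le>j. \<Sum>i<j. recursion_coeff j i * monic_power_sum e i)"
    unfolding sum.atMost_Suc_shift monic_power_sum_0_left monic_power_sum_Suc ..
  also have "(\<Sum>e\<le>j. \<Sum>i<j. recursion_coeff j i * monic_power_sum e i) = (\<Sum>i<j. recursion_coeff j i * zeta_value i)"
    by (subst sum.swap, rule sum.cong) (auto simp: zeta_value_extend[where n = j] sum_distrib_left)
  finally show ?thesis .
qed

lemma zeta_deriv_rec: "zeta_deriv j = (\<Sum>i<j. recursion_coeff j i * (zeta_value i + zeta_deriv i))"
proof -
  have "zeta_deriv j = (\<Sum>e\<le>Suc j. of_nat e * monic_power_sum e j)"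
    by (rule zeta_deriv_extend) simp
  also have "\<dots> = (\<Sum>e\<le>j. \<Sum>i<j. recursion_coeff j i * (of_nat (Suc e) * monic_power_sum e i))"
    unfolding sum.atMost_Suc_shift monic_power_sum_Suc by (simp add: sum_distrib_left mult_ac)
  also have "\<dots> = (\<Sum>i<j. recursion_coeff j i * (zeta_value i + zeta_deriv i))"
    by (subst sum.swap, rule sum.cong)
       (auto simp: zeta_value_extend[where n = j] zeta_deriv_extend[where n = j] distrib_right
                   sum.distrib simp flip: sum_distrib_left)
  finally show ?thesis .
qed

lemma recursion_coeff_eq_0:
  assumes "\<not> (CARD('a) - 1) dvd (j - i)"
  shows "recursion_coeff j i = (0 :: 'a :: {field, finite} poly)"
  using assms by (simp add: recursion_coeff_def power_sum_finite_field)

lemma recursion_coeff_0_right: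
  assumes "j > 0"
  shows "recursion_coeff j 0 = (if (CARD('a) - 1) dvd j then -1 else 0 :: 'a :: {field, finite} poly)"
  using assms by (simp add: recursion_coeff_def power_sum_finite_field one_pCons)

lemma poly_recursion_coeff_at_0:
  assumes "i > 0"
  shows "poly (recursion_coeff j i) 0 = 0"
  using assms by (simp add: recursion_coeff_def)

lemma zeta_value_0: "zeta_value 0 = 1"
  by (simp add: zeta_value_def monic_power_sum_0_left)

lemma zeta_deriv_0: "zeta_deriv 0 = 0"
  by (simp add: zeta_deriv_def)

lemma poly_sum_lessThan_at_0:
  assumes "j > 0"
  shows "poly (\<Sum>i<j. recursion_coeff j i * f i) 0 = poly (recursion_coeff j 0 * f 0) 0"
proof -
  have "poly (\<Sum>i<j. recursion_coeff j i * f i) 0 = (\<Sum>i<j. poly (recursion_coeff j i * f i) 0)"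
    by (rule poly_sum)
  also have "\<dots> = (\<Sum>i\<in>{0}. poly (recursion_coeff j i * f i) 0)"
    by (rule sum.mono_neutral_right) (use assms in \<open>auto simp: poly_recursion_coeff_at_0\<close>)
  finally show ?thesis by simp
qed

text \<open>
  By induction only \<open>i = 0\<close> survives in the recursion: for other \<open>i\<close>, either \<open>q - 1\<close> does not divide
  \<open>j - i\<close> and the coefficient vanishes, or \<open>q - 1\<close> divides \<open>i\<close> and the value at \<open>i\<close> vanishes. The term
  \<open>i = 0\<close> is \<open>-1\<close> and cancels the leading \<open>1\<close>.
\<close>

lemma zeta_value_eq_0:
  assumes "j > 0" "(CARD('a) - 1) dvd j"
  shows "zeta_value j = (0 :: 'a :: {field, finite} poly)"
  using assms
proof (induction j rule: less_induct)
  case (less j)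
  have "(\<Sum>i<j. recursion_coeff j i * zeta_value i) = (\<Sum>i\<in>{0}. recursion_coeff j i * zeta_value i :: 'a poly)"
  proof (rule sum.mono_neutral_right)
    show "\<forall>i\<in>{..<j} - {0}. recursion_coeff j i * zeta_value i = (0 :: 'a poly)"
    proof
      fix i assume i: "i \<in> {..<j} - {0}"
      show "recursion_coeff j i * zeta_value i = (0 :: 'a poly)"
      proof (cases "(CARD('a) - 1) dvd i")
        case True
        then show ?thesis using less.IH[of i] i by auto
      next
        case False
        then have "\<not> (CARD('a) - 1) dvd (j - i)"
          using i less.prems(2) dvd_diffD1[of "CARD('a) - 1" j i] by auto
        then show ?thesis by (simp add: recursion_coeff_eq_0)
      qed
    qed
  qed (use less.prems in auto)
  also have "\<dots> = -1" using less.prems by (simp add: recursion_coeff_0_right zeta_value_0)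
  finally show ?case by (subst zeta_value_rec) simp
qed

text \<open>
  Modulo \<open>T\<close> the recursion reduces to its term \<open>i = 0\<close>, because the coefficients contain \<open>T ^ i\<close>. That
  term alone shows that the derivative here, and the value in the next lemma, are nonzero.
\<close>

lemma zeta_deriv_at_0:
  assumes "j > 0" "(CARD('a) - 1) dvd j"
  shows "poly (zeta_deriv j) 0 = (-1 :: 'a :: {field, finite})"
  by (subst zeta_deriv_rec, subst poly_sum_lessThan_at_0)
     (use assms in \<open>simp_all add: recursion_coeff_0_right zeta_value_0 zeta_deriv_0\<close>)

lemma zeta_value_at_0:
  assumes "\<not> (CARD('a) - 1) dvd j"
  shows "poly (zeta_value j) 0 = (1 :: 'a :: {field, finite})"
proof -
  have "j > 0" using assms by (cases j) auto
  then show ?thesis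
    by (subst zeta_value_rec, subst poly_add, subst poly_sum_lessThan_at_0)
       (use assms in \<open>simp_all add: recursion_coeff_0_right zeta_value_0\<close>)
qed

section \<open>Orders of vanishing over a field with an absolute value\<close>

text \<open>
  A field with a nontrivial absolute value that induces its metric. The triangle inequality is the one
  of the metric, and nontriviality provides arbitrarily small nonzero elements.
\<close>

locale absolute_value =
  fixes nrm :: "'c :: {field, metric_space} \<Rightarrow> real"
  assumes dist_eq: "dist x y = nrm (x - y)"
    and nrm_mult: "nrm (x * y) = nrm x * nrm y"
    and nontrivial: "\<exists>x. 0 < nrm x \<and> nrm x < 1"
begin

lemma nrm_conv_dist: "nrm x = dist x 0"
  by (simp add: dist_eq)

lemma nrm_nonneg [simp]: "0 \<le> nrm x"
  by (simp add: nrm_conv_dist)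

lemma nrm_eq_0_iff [simp]: "nrm x = 0 \<longleftrightarrow> x = 0"
  by (simp add: nrm_conv_dist)

lemma nrm_pos_iff [simp]: "0 < nrm x \<longleftrightarrow> x \<noteq> 0"
  by (simp add: nrm_conv_dist)

lemma nrm_0 [simp]: "nrm 0 = 0"
  by simp

lemma nrm_1 [simp]: "nrm 1 = 1"
proof -
  have "nrm 1 * nrm 1 = nrm 1 * 1" using nrm_mult[of 1 1] by simp
  then show ?thesis by (metis mult_left_cancel nrm_eq_0_iff zero_neq_one)
qed

lemma nrm_minus [simp]: "nrm (- x) = nrm x"
  using dist_eq[of 0 x] by (simp add: nrm_conv_dist dist_commute)

lemma nrm_power [simp]: "nrm (x ^ n) = nrm x ^ n"
  by (induction n) (simp_all add: nrm_mult)

lemma nrm_triangle: "nrm (x + y) \<le> nrm x + nrm y"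
  using dist_triangle[of x "- y" 0] by (simp add: dist_eq)

lemma nrm_divide: "nrm (x / y) = nrm x / nrm y"
proof (cases "y = 0")
  case False
  have "nrm (x / y) * nrm y = nrm x" using False by (simp flip: nrm_mult)
  with False show ?thesis by (simp add: field_simps)
qed simp

lemma nrm_sum_le: "nrm (\<Sum>i\<in>A. f i) \<le> (\<Sum>i\<in>A. nrm (f i))"
proof (induction A rule: infinite_finite_induct)
  case (insert x A)
  then show ?case using nrm_triangle[of "f x" "sum f A"] by simp
qed auto

lemma ex_nrm_less:
  assumes "0 < \<epsilon>"
  obtains h where "h \<noteq> 0" "nrm h < \<epsilon>"
proof -
  obtain x where x: "0 < nrm x" "nrm x < 1" using nontrivial by blast
  then obtain n where "nrm x ^ n < \<epsilon>" using real_arch_pow_inv[OF assms] by blast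
  with x that[of "x ^ n"] show thesis by simp
qed

lemma sums_imp_nrm_tendsto_0:
  assumes "f sums s"
  shows "(\<lambda>n. nrm (f n)) \<longlonglongrightarrow> 0"
proof -
  have S: "(\<lambda>n. \<Sum>i<n. f i) \<longlonglongrightarrow> s" using assms by (simp add: sums_def)
  have "(\<lambda>n. dist (\<Sum>i<Suc n. f i) (\<Sum>i<n. f i)) \<longlonglongrightarrow> dist s s"
    by (rule tendsto_dist[OF LIMSEQ_Suc[OF S] S])
  then show ?thesis by (simp add: dist_eq)
qed

text \<open>
  The terms of a series that converges at some \<open>y \<noteq> 0\<close> are bounded there, so the terms of index above
  \<open>n\<close> at \<open>h\<close> with \<open>\<bar>h\<bar> \<le> \<bar>y\<bar> / 2\<close> are dominated by a geometric series of ratio \<open>1 / 2\<close> starting at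
  \<open>(\<bar>h\<bar> / \<bar>y\<bar>) ^ (n + 1)\<close>.
\<close>

lemma leading_term_estimate:
  fixes x\<^sub>0 :: 'c
  assumes "r > 0" and g: "\<And>x. x \<in> ball x\<^sub>0 r \<Longrightarrow> (\<lambda>k. a k * (x - x\<^sub>0) ^ k) sums g x"
    and a: "\<And>k. k < n \<Longrightarrow> a k = 0"
  shows "\<exists>\<delta>>0. \<exists>K. \<forall>h. nrm h < \<delta> \<longrightarrow> nrm (g (x\<^sub>0 + h) - a n * h ^ n) \<le> K * nrm h ^ Suc n"
proof -
  have g': "(\<lambda>k. a k * h ^ k) sums g (x\<^sub>0 + h)" if "nrm h < r" for h
    using g[of "x\<^sub>0 + h"] that by (simp add: dist_eq)
  obtain y where y: "y \<noteq> 0" "nrm y < r" using ex_nrm_less[OF \<open>r > 0\<close>] .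
  define \<rho> where "\<rho> = nrm y"
  have \<rho>: "0 < \<rho>" "\<rho> < r" using y by (simp_all add: \<rho>_def)
  have "Bseq (\<lambda>k. nrm (a k * y ^ k))"
    using sums_imp_nrm_tendsto_0[OF g'[OF y(2)]] by (intro convergent_imp_Bseq convergentI)
  then obtain M where M: "\<And>k. nrm (a k) * \<rho> ^ k \<le> M" "M > 0"
    unfolding Bseq_def by (auto simp: nrm_mult \<rho>_def)
  define K where "K = 2 * M / \<rho> ^ Suc n"
  have "nrm (g (x\<^sub>0 + h) - a n * h ^ n) \<le> K * nrm h ^ Suc n" if h: "nrm h < \<rho> / 2" for h
  proof -
    define t where "t = nrm h / \<rho>"
    have t: "0 \<le> t" "t \<le> 1 / 2" using h \<rho> by (simp_all add: t_def field_simps)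
    have "nrm h < r" using h \<rho> by simp
    from g'[OF this] have S: "(\<lambda>N. \<Sum>k<N. a k * h ^ k) \<longlonglongrightarrow> g (x\<^sub>0 + h)" by (simp add: sums_def)
    have lim: "(\<lambda>m. dist (\<Sum>k<m + Suc n. a k * h ^ k) (a n * h ^ n))
                  \<longlonglongrightarrow> dist (g (x\<^sub>0 + h)) (a n * h ^ n)"
      by (rule tendsto_dist[OF LIMSEQ_ignore_initial_segment[OF S] tendsto_const])
    have "dist (\<Sum>k<m + Suc n. a k * h ^ k) (a n * h ^ n) \<le> K * nrm h ^ Suc n" for m
    proof -
      have "(\<Sum>k<m + Suc n. a k * h ^ k) = (\<Sum>k<Suc n. a k * h ^ k) + (\<Sum>k<m. a (Suc n + k) * h ^ (Suc n + k))"
        by (induction m) (simp_all add: add_ac)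
      also have "(\<Sum>k<Suc n. a k * h ^ k) = a n * h ^ n" using a by simp
      finally have "dist (\<Sum>k<m + Suc n. a k * h ^ k) (a n * h ^ n) = nrm (\<Sum>k<m. a (Suc n + k) * h ^ (Suc n + k))"
        by (simp add: dist_eq)
      also have "\<dots> \<le> (\<Sum>k<m. nrm (a (Suc n + k) * h ^ (Suc n + k)))" by (rule nrm_sum_le)
      also have "\<dots> \<le> (\<Sum>k<m. M * t ^ Suc n * (1 / 2) ^ k)"
      proof (rule sum_mono)
        fix k
        have "nrm (a (Suc n + k) * h ^ (Suc n + k)) = nrm (a (Suc n + k)) * \<rho> ^ (Suc n + k) * t ^ (Suc n + k)"
          using \<rho> by (simp add: nrm_mult t_def power_divide)
        also have "\<dots> \<le> M * t ^ (Suc n + k)" by (rule mult_right_mono[OF M(1)]) (simp add: t(1))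
        also have "\<dots> = M * t ^ Suc n * t ^ k" by (simp add: power_add)
        also have "\<dots> \<le> M * t ^ Suc n * (1 / 2) ^ k"
          using M(2) t by (intro mult_left_mono power_mono) auto
        finally show "nrm (a (Suc n + k) * h ^ (Suc n + k)) \<le> M * t ^ Suc n * (1 / 2) ^ k" .
      qed
      also have "\<dots> = M * t ^ Suc n * (\<Sum>k<m. (1 / 2) ^ k)" by (simp add: sum_distrib_left)
      also have "(\<Sum>k<m. (1 / 2 :: real) ^ k) \<le> 2"
        by (simp add: sum_gp_strict)
      then have "M * t ^ Suc n * (\<Sum>k<m. (1 / 2) ^ k) \<le> M * t ^ Suc n * 2"
        using M(2) t by (intro mult_left_mono) auto
      also have "M * t ^ Suc n * 2 = K * nrm h ^ Suc n" by (simp add: K_def t_def power_divide)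
      finally show ?thesis .
    qed
    then have "dist (g (x\<^sub>0 + h)) (a n * h ^ n) \<le> K * nrm h ^ Suc n"
      by (intro LIMSEQ_le_const2[OF lim] exI[of _ 0]) blast
    then show ?thesis by (simp add: dist_eq)
  qed
  with \<rho>(1) show ?thesis by (intro exI[of _ "\<rho> / 2"] exI[of _ K] conjI allI impI) auto
qed

text \<open>
  If \<open>n < m\<close>, then near the point the function is both close to a nonzero multiple of \<open>h ^ n\<close> and
  of size \<open>O(h ^ (n + 1))\<close>. Since there are arbitrarily small nonzero \<open>h\<close>, this is impossible.
\<close>

lemma has_zero_order_le:
  fixes x\<^sub>0 :: 'c
  assumes "has_zero_order g x\<^sub>0 n" "has_zero_order g x\<^sub>0 m"
  shows "m \<le> n"
proof (rule ccontr)
  assume "\<not> m \<le> n"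
  then have nm: "Suc n \<le> m" by simp
  obtain a r where a: "r > 0" "\<And>x. x \<in> ball x\<^sub>0 r \<Longrightarrow> (\<lambda>k. a k * (x - x\<^sub>0) ^ k) sums g x"
      "\<And>k. k < n \<Longrightarrow> a k = 0" "a n \<noteq> 0"
    using assms(1) unfolding has_zero_order_def by blast
  obtain b s where b: "s > 0" "\<And>x. x \<in> ball x\<^sub>0 s \<Longrightarrow> (\<lambda>k. b k * (x - x\<^sub>0) ^ k) sums g x"
      "\<And>k. k < m \<Longrightarrow> b k = 0"
    using assms(2) unfolding has_zero_order_def by blast
  have "\<exists>\<delta>>0. \<exists>K. \<forall>h. nrm h < \<delta> \<longrightarrow> nrm (g (x\<^sub>0 + h) - a n * h ^ n) \<le> K * nrm h ^ Suc n"
    by (rule leading_term_estimate[OF a(1)]) (fact a)+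
  then obtain \<delta> K where K: "\<delta> > 0" "\<And>h. nrm h < \<delta> \<Longrightarrow> nrm (g (x\<^sub>0 + h) - a n * h ^ n) \<le> K * nrm h ^ Suc n"
    by blast
  have "\<exists>\<epsilon>>0. \<exists>L. \<forall>h. nrm h < \<epsilon> \<longrightarrow> nrm (g (x\<^sub>0 + h) - b m * h ^ m) \<le> L * nrm h ^ Suc m"
    by (rule leading_term_estimate[OF b(1)]) (fact b)+
  then obtain \<epsilon> L where L: "\<epsilon> > 0" "\<And>h. nrm h < \<epsilon> \<Longrightarrow> nrm (g (x\<^sub>0 + h) - b m * h ^ m) \<le> L * nrm h ^ Suc m"
    by blast
  define B where "B = \<bar>K\<bar> + \<bar>L\<bar> + nrm (b m) + 1"
  have "B > 0" by (simp add: B_def add_nonneg_pos)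
  have "0 < Min {\<delta>, \<epsilon>, 1, nrm (a n) / B}" using K L a(4) \<open>B > 0\<close> by simp
  then obtain h where h: "h \<noteq> 0" "nrm h < Min {\<delta>, \<epsilon>, 1, nrm (a n) / B}" using ex_nrm_less by blast
  have small: "nrm h < \<delta>" "nrm h < \<epsilon>" "nrm h < 1" "nrm h < nrm (a n) / B" using h(2) by simp_all
  have pow: "nrm h ^ m \<le> nrm h ^ Suc n" "nrm h ^ Suc m \<le> nrm h ^ Suc n"
    using nm small(3) by (intro power_decreasing; simp)+
  have "a n * h ^ n = - (g (x\<^sub>0 + h) - a n * h ^ n) + ((g (x\<^sub>0 + h) - b m * h ^ m) + b m * h ^ m)"
    by simp
  then have "nrm (a n * h ^ n) \<le> nrm (- (g (x\<^sub>0 + h) - a n * h ^ n)) + nrm ((g (x\<^sub>0 + h) - b m * h ^ m) + b m * h ^ m)"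
    by (metis nrm_triangle)
  also have "\<dots> \<le> nrm (g (x\<^sub>0 + h) - a n * h ^ n) + (nrm (g (x\<^sub>0 + h) - b m * h ^ m) + nrm (b m * h ^ m))"
    using nrm_triangle[of "g (x\<^sub>0 + h) - b m * h ^ m" "b m * h ^ m"] by (simp only: nrm_minus)
  also have "\<dots> \<le> K * nrm h ^ Suc n + (L * nrm h ^ Suc m + nrm (b m) * nrm h ^ m)"
    using K(2)[OF small(1)] L(2)[OF small(2)] by (simp add: nrm_mult)
  also have "\<dots> \<le> \<bar>K\<bar> * nrm h ^ Suc n + (\<bar>L\<bar> * nrm h ^ Suc n + nrm (b m) * nrm h ^ Suc n)"
    using pow by (intro add_mono mult_mono) auto
  also have "\<dots> \<le> B * nrm h ^ Suc n"
    by (simp add: B_def algebra_simps)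
  finally have "nrm (a n) * nrm h ^ n \<le> (B * nrm h) * nrm h ^ n" by (simp add: nrm_mult mult_ac)
  then have "nrm (a n) \<le> B * nrm h" using h(1) by simp
  with small(4) \<open>B > 0\<close> show False by (simp add: field_simps)
qed

lemma zero_order_eqI:
  fixes x\<^sub>0 :: 'c
  assumes "has_zero_order g x\<^sub>0 n"
  shows "zero_order g x\<^sub>0 = n"
  unfolding zero_order_def
proof (rule the_equality)
  show "has_zero_order g x\<^sub>0 n" by fact
next
  fix m assume "has_zero_order g x\<^sub>0 m"
  then show "m = n" using has_zero_order_le[of g x\<^sub>0] assms by (intro order.antisym)
qed

text \<open>
  For a polynomial in \<open>w = x\<^sub>0 / (x\<^sub>0 + h)\<close> the expansion in \<open>h\<close> is built along Horner's scheme
  \<open>P \<mapsto> s + w * P\<close>. Multiplying by \<open>w\<close> turns the coefficients \<open>a\<close> into \<open>d\<close> with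
  \<open>d (k + 1) = a (k + 1) - d k / x\<^sub>0\<close>, which is the identity \<open>(x\<^sub>0 + h) * (\<Sum>k. d k * h ^ k) = x\<^sub>0 * (\<Sum>k. a k * h ^ k)\<close>
  read off coefficientwise. The first two coefficients follow the chain rule for \<open>P(w)\<close>, as
  \<open>w = 1\<close> and \<open>dw/dh = -1 / x\<^sub>0\<close> at \<open>h = 0\<close>.
  
  The growth bound \<open>\<bar>a k\<bar> * \<bar>x\<^sub>0\<bar> ^ k \<le> M * 2 ^ k\<close> makes the induction work for every degree at the same
  radius: multiplication by \<open>w\<close> at most doubles \<open>M\<close> and keeps the rate \<open>2\<close>.
\<close>

lemma expansion_poly_quotient:
  assumes x0: "x\<^sub>0 \<noteq> 0"
  shows "\<exists>(a :: nat \<Rightarrow> 'c) M. (\<forall>k. nrm (a k) * nrm x\<^sub>0 ^ k \<le> M * 2 ^ k) \<and>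
           (\<forall>h. nrm h < nrm x\<^sub>0 / 4 \<longrightarrow> (\<lambda>k. a k * h ^ k) sums poly P (x\<^sub>0 / (x\<^sub>0 + h))) \<and>
           a 0 = poly P 1 \<and> a 1 = - poly (pderiv P) 1 / x\<^sub>0"
proof (induction P)
  case 0
  show ?case by (rule exI[of _ "\<lambda>_. 0"], rule exI[of _ 0]) simp
next
  case (pCons s P)
  then obtain a M where bound: "\<And>k. nrm (a k) * nrm x\<^sub>0 ^ k \<le> M * 2 ^ k"
    and sums: "\<And>h. nrm h < nrm x\<^sub>0 / 4 \<Longrightarrow> (\<lambda>k. a k * h ^ k) sums poly P (x\<^sub>0 / (x\<^sub>0 + h))"
    and a0: "a 0 = poly P 1" and a1: "a 1 = - poly (pderiv P) 1 / x\<^sub>0"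
    by blast
  define d where "d = rec_nat (a 0) (\<lambda>k d_k. a (Suc k) - d_k / x\<^sub>0)"
  have d_0: "d 0 = a 0" and d_Suc: "\<And>k. d (Suc k) = a (Suc k) - d k / x\<^sub>0"
    by (simp_all add: d_def)
  define b where "b k = (if k = 0 then s else 0) + d k" for k
  have "M \<ge> 0" using bound[of 0] order.trans[OF nrm_nonneg[of "a 0"]] by simp
  have d_bound: "nrm (d k) * nrm x\<^sub>0 ^ k \<le> 2 * M * 2 ^ k" for k
  proof (induction k)
    case 0
    show ?case using bound[of 0] \<open>M \<ge> 0\<close> by (simp add: d_0)
  next
    case (Suc k)
    have "nrm (d (Suc k)) \<le> nrm (a (Suc k)) + nrm (d k) / nrm x\<^sub>0"
      using nrm_triangle[of "a (Suc k)" "- (d k / x\<^sub>0)"] by (simp add: d_Suc nrm_divide)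
    then have "nrm (d (Suc k)) * nrm x\<^sub>0 ^ Suc k \<le> (nrm (a (Suc k)) + nrm (d k) / nrm x\<^sub>0) * nrm x\<^sub>0 ^ Suc k"
      by (rule mult_right_mono) simp
    also have "\<dots> = nrm (a (Suc k)) * nrm x\<^sub>0 ^ Suc k + nrm (d k) * nrm x\<^sub>0 ^ k"
      using x0 by (simp add: distrib_right)
    also have "\<dots> \<le> M * 2 ^ Suc k + 2 * M * 2 ^ k" by (intro add_mono bound Suc)
    finally show ?case by simp
  qed
  have b_sums: "(\<lambda>k. b k * h ^ k) sums poly (pCons s P) (x\<^sub>0 / (x\<^sub>0 + h))" if h: "nrm h < nrm x\<^sub>0 / 4" for h
  proof -
    define v where "v = poly P (x\<^sub>0 / (x\<^sub>0 + h))"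
    have "x\<^sub>0 + h \<noteq> 0"
    proof
      assume "x\<^sub>0 + h = 0"
      then have "h = - x\<^sub>0" by (simp add: add_eq_0_iff)
      with h x0 show False by simp
    qed
    \<comment> \<open>This identity of series holds for partial sums up to one boundary term. It is at most
        a constant times \<open>(2 * \<bar>h\<bar> / \<bar>x\<^sub>0\<bar>) ^ N\<close>, so \<open>\<bar>h\<bar> < \<bar>x\<^sub>0\<bar> / 4\<close> makes it vanish in the limit.\<close>
    have partial: "(x\<^sub>0 + h) * (\<Sum>k<Suc N. d k * h ^ k) = x\<^sub>0 * (\<Sum>k<Suc N. a k * h ^ k) + d N * h ^ Suc N" for N
    proof (induction N)
      case 0
      show ?case by (simp add: d_0 algebra_simps)
    next
      case (Suc N)
      have *: "x\<^sub>0 * d (Suc N) = x\<^sub>0 * a (Suc N) - d N" using x0 by (simp add: d_Suc right_diff_distrib)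
      have "(x\<^sub>0 + h) * (\<Sum>k<Suc (Suc N). d k * h ^ k) =
              x\<^sub>0 * (\<Sum>k<Suc N. a k * h ^ k) + d N * h ^ Suc N + (x\<^sub>0 * d (Suc N)) * h ^ Suc N + d (Suc N) * h ^ Suc (Suc N)"
        unfolding sum.lessThan_Suc[of _ "Suc N"] distrib_left[of "x\<^sub>0 + h"] Suc.IH
        by (simp add: algebra_simps del: sum.lessThan_Suc)
      also have "\<dots> = x\<^sub>0 * (\<Sum>k<Suc (Suc N). a k * h ^ k) + d (Suc N) * h ^ Suc (Suc N)"
        unfolding * sum.lessThan_Suc[of _ "Suc N"] by (simp add: algebra_simps del: sum.lessThan_Suc)
      finally show ?case .
    qed
    have b_partial: "(\<Sum>k<Suc N. b k * h ^ k) = s + (\<Sum>k<Suc N. d k * h ^ k)" for N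
      by (induction N) (simp_all add: b_def algebra_simps)
    have dist_le: "dist (\<Sum>k<Suc N. b k * h ^ k) (s + x\<^sub>0 / (x\<^sub>0 + h) * v)
       \<le> (nrm x\<^sub>0 * dist (\<Sum>k<Suc N. a k * h ^ k) v + 2 * M * nrm h * (2 * (nrm h / nrm x\<^sub>0)) ^ N) / nrm (x\<^sub>0 + h)" for N
    proof -
      have "dist (\<Sum>k<Suc N. b k * h ^ k) (s + x\<^sub>0 / (x\<^sub>0 + h) * v) =
              nrm ((\<Sum>k<Suc N. d k * h ^ k) - x\<^sub>0 / (x\<^sub>0 + h) * v)"
        unfolding dist_eq b_partial by (simp del: sum.lessThan_Suc)
      also have "(\<Sum>k<Suc N. d k * h ^ k) - x\<^sub>0 / (x\<^sub>0 + h) * v =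
              ((x\<^sub>0 + h) * (\<Sum>k<Suc N. d k * h ^ k) - x\<^sub>0 * v) / (x\<^sub>0 + h)"
        using \<open>x\<^sub>0 + h \<noteq> 0\<close> by (simp add: diff_divide_distrib del: sum.lessThan_Suc)
      also have "(x\<^sub>0 + h) * (\<Sum>k<Suc N. d k * h ^ k) - x\<^sub>0 * v =
              x\<^sub>0 * ((\<Sum>k<Suc N. a k * h ^ k) - v) + d N * h ^ Suc N"
        unfolding partial by (simp add: right_diff_distrib del: sum.lessThan_Suc)
      also have "nrm (\<dots> / (x\<^sub>0 + h)) = nrm \<dots> / nrm (x\<^sub>0 + h)" by (rule nrm_divide)
      also have "\<dots> \<le> (nrm (x\<^sub>0 * ((\<Sum>k<Suc N. a k * h ^ k) - v)) + nrm (d N * h ^ Suc N)) / nrm (x\<^sub>0 + h)"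
        by (intro divide_right_mono nrm_triangle) simp
      also have "nrm (x\<^sub>0 * ((\<Sum>k<Suc N. a k * h ^ k) - v)) = nrm x\<^sub>0 * dist (\<Sum>k<Suc N. a k * h ^ k) v"
        by (simp add: nrm_mult dist_eq del: sum.lessThan_Suc)
      also have "nrm (d N * h ^ Suc N) = nrm (d N) * nrm x\<^sub>0 ^ N * (nrm h * (nrm h / nrm x\<^sub>0) ^ N)"
        using x0 by (simp add: nrm_mult power_divide)
      also have "\<dots> \<le> 2 * M * 2 ^ N * (nrm h * (nrm h / nrm x\<^sub>0) ^ N)"
        by (intro mult_right_mono d_bound) simp
      also have "\<dots> = 2 * M * nrm h * (2 * (nrm h / nrm x\<^sub>0)) ^ N"
        by (simp only: power_mult_distrib mult_ac)
      finally show ?thesis by (simp add: divide_right_mono del: sum.lessThan_Suc)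
    qed
    have "(\<lambda>N. \<Sum>k<Suc N. a k * h ^ k) \<longlonglongrightarrow> v"
      using sums[OF h] unfolding sums_def v_def by (rule LIMSEQ_Suc)
    then have "(\<lambda>N. dist (\<Sum>k<Suc N. a k * h ^ k) v) \<longlonglongrightarrow> 0" by (rule iffD1[OF tendsto_dist_iff])
    moreover have "2 * nrm h < nrm x\<^sub>0" using h nrm_nonneg[of h] by linarith
    then have "(\<lambda>N. (2 * (nrm h / nrm x\<^sub>0)) ^ N) \<longlonglongrightarrow> 0"
      by (intro LIMSEQ_power_zero) (use x0 in \<open>simp add: field_simps\<close>)
    ultimately have lim: "(\<lambda>N. (nrm x\<^sub>0 * dist (\<Sum>k<Suc N. a k * h ^ k) v + 2 * M * nrm h * (2 * (nrm h / nrm x\<^sub>0)) ^ N) / nrm (x\<^sub>0 + h))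
         \<longlonglongrightarrow> (nrm x\<^sub>0 * 0 + 2 * M * nrm h * 0) / nrm (x\<^sub>0 + h)"
      by (intro tendsto_divide tendsto_add tendsto_mult tendsto_const)
         (use \<open>x\<^sub>0 + h \<noteq> 0\<close> in \<open>simp_all del: sum.lessThan_Suc\<close>)
    have "(\<lambda>N. dist (\<Sum>k<Suc N. b k * h ^ k) (s + x\<^sub>0 / (x\<^sub>0 + h) * v)) \<longlonglongrightarrow> 0"
    proof (rule tendsto_sandwich[OF _ _ tendsto_const])
      show "\<forall>\<^sub>F N in sequentially. 0 \<le> dist (\<Sum>k<Suc N. b k * h ^ k) (s + x\<^sub>0 / (x\<^sub>0 + h) * v)"
        by (intro always_eventually allI zero_le_dist)
      show "\<forall>\<^sub>F N in sequentially. dist (\<Sum>k<Suc N. b k * h ^ k) (s + x\<^sub>0 / (x\<^sub>0 + h) * v)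
              \<le> (nrm x\<^sub>0 * dist (\<Sum>k<Suc N. a k * h ^ k) v + 2 * M * nrm h * (2 * (nrm h / nrm x\<^sub>0)) ^ N) / nrm (x\<^sub>0 + h)"
        by (intro always_eventually allI dist_le)
    qed (use lim in \<open>simp only: mult_zero_right add_0_right div_0\<close>)
    then have "(\<lambda>N. \<Sum>k<Suc N. b k * h ^ k) \<longlonglongrightarrow> s + x\<^sub>0 / (x\<^sub>0 + h) * v" by (rule iffD2[OF tendsto_dist_iff])
    then show ?thesis unfolding sums_def v_def poly_pCons by (rule LIMSEQ_imp_Suc)
  qed
  show ?case
  proof (intro exI[of _ b] exI[of _ "nrm s + 2 * M"] conjI allI impI)
    fix k
    have "nrm (b k) * nrm x\<^sub>0 ^ k \<le> nrm s + nrm (d k) * nrm x\<^sub>0 ^ k"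
      using nrm_triangle[of s "d 0"] by (cases k) (simp_all add: b_def)
    also have "\<dots> \<le> nrm s * 2 ^ k + 2 * M * 2 ^ k"
      using d_bound[of k] mult_left_mono[of 1 "2 ^ k" "nrm s"] by simp
    finally show "nrm (b k) * nrm x\<^sub>0 ^ k \<le> (nrm s + 2 * M) * 2 ^ k" by (simp add: distrib_right)
  next
    show "b 0 = poly (pCons s P) 1" by (simp add: b_def d_0 a0)
    show "b 1 = - poly (pderiv (pCons s P)) 1 / x\<^sub>0"
      using d_Suc[of 0] by (simp add: b_def d_0 a0 a1[simplified] pderiv_pCons diff_divide_distrib add_divide_distrib)
  qed (rule b_sums)
qed

lemma zero_order_poly_quotient:
  fixes x\<^sub>0 :: 'c
  assumes "x\<^sub>0 \<noteq> 0"
  shows "poly P 1 \<noteq> 0 \<Longrightarrow> zero_order (\<lambda>x. poly P (x\<^sub>0 / x)) x\<^sub>0 = 0"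
    and "poly P 1 = 0 \<Longrightarrow> poly (pderiv P) 1 \<noteq> 0 \<Longrightarrow> zero_order (\<lambda>x. poly P (x\<^sub>0 / x)) x\<^sub>0 = 1"
proof -
  obtain a where sums: "\<And>h. nrm h < nrm x\<^sub>0 / 4 \<Longrightarrow> (\<lambda>k. a k * h ^ k) sums poly P (x\<^sub>0 / (x\<^sub>0 + h))"
    and a: "a 0 = poly P 1" "a 1 = - poly (pderiv P) 1 / x\<^sub>0"
    using expansion_poly_quotient[OF assms, of P] by auto
  have "\<forall>x\<in>ball x\<^sub>0 (nrm x\<^sub>0 / 4). (\<lambda>k. a k * (x - x\<^sub>0) ^ k) sums poly P (x\<^sub>0 / x)"
  proof
    fix x assume "x \<in> ball x\<^sub>0 (nrm x\<^sub>0 / 4)"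
    then have "nrm (x - x\<^sub>0) < nrm x\<^sub>0 / 4" by (simp add: dist_commute flip: dist_eq)
    from sums[OF this] show "(\<lambda>k. a k * (x - x\<^sub>0) ^ k) sums poly P (x\<^sub>0 / x)" by simp
  qed
  moreover have "nrm x\<^sub>0 / 4 > 0" using assms by simp
  ultimately have "has_zero_order (\<lambda>x. poly P (x\<^sub>0 / x)) x\<^sub>0 n" if "\<forall>k<n. a k = 0" "a n \<noteq> 0" for n
    using that unfolding has_zero_order_def by blast
  then show "poly P 1 \<noteq> 0 \<Longrightarrow> zero_order (\<lambda>x. poly P (x\<^sub>0 / x)) x\<^sub>0 = 0"
    and "poly P 1 = 0 \<Longrightarrow> poly (pderiv P) 1 \<noteq> 0 \<Longrightarrow> zero_order (\<lambda>x. poly P (x\<^sub>0 / x)) x\<^sub>0 = 1"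
    using a assms by (auto intro!: zero_order_eqI)
qed

end

section \<open>The zeta function at negative integers\<close>

lemma prod_of_nat_diff: "(\<Prod>k<i. of_nat j - of_nat k :: 'r :: {comm_ring_1, semiring_char_0}) = fact i * of_nat (j choose i)"
proof (induction i)
  case (Suc i)
  have "of_nat (j choose i) * (of_nat j - of_nat i) = (of_nat (Suc i) * of_nat (j choose Suc i) :: 'r)"
  proof (cases "i \<le> j")
    case True
    then have "of_nat (j choose i) * (of_nat j - of_nat i) = (of_nat ((j - i) * (j choose i)) :: 'r)"
      by (simp add: of_nat_diff)
    also have "(j - i) * (j choose i) = Suc i * (j choose Suc i)"
      by (simp only: binomial_absorb_comp binomial_absorption)
    finally show ?thesis by (simp only: of_nat_mult)
  next
    case False
    then show ?thesis by (simp add: not_le binomial_eq_0)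
  qed
  with Suc show ?case by (simp add: mult.assoc mult.left_commute)
qed simp

lemma padic_binomial_of_nat:
  "padic_binomial (of_nat j :: 'a :: {field, finite} padic_int) i = of_nat (j choose i)"
  unfolding padic_binomial_def prod_of_nat_diff by (rule nonzero_mult_div_cancel_left) simp

text \<open>
  The residue modulo \<open>p\<close> through which a \<open>p\<close>-adic binomial coefficient acts is that of the ordinary
  binomial coefficient.
\<close>

lemma of_int_mod_CHAR: "of_int (int k mod int CHAR('r)) = (of_nat k :: 'r :: comm_ring_1)"
proof -
  have "(of_nat k :: 'r) = of_nat (k mod CHAR('r) + CHAR('r) * (k div CHAR('r)))" by simp
  also have "\<dots> = of_nat (k mod CHAR('r))" by (simp only: of_nat_add of_nat_mult of_nat_CHAR) simp
  also have "\<dots> = of_int (int k mod int CHAR('r))" by (simp flip: zmod_int)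
  finally show ?thesis ..
qed

text \<open>
  At a natural exponent the binomial series is the finite binomial expansion of \<open>((u - 1) + 1) ^ j\<close>.
\<close>

lemma one_unit_powr_of_nat: "one_unit_powr u (of_nat j) = u ^ j"
proof -
  have "of_int (padic_nth (padic_binomial (of_nat j :: 'a padic_int) i) 1) = (of_nat (j choose i) :: 'a fls)" for i
    using of_int_mod_CHAR[of "j choose i", where 'r = "'a fls"]
    by (simp add: padic_binomial_of_nat padic_nth_of_nat)
  then have "one_unit_powr u (of_nat j) = (\<Sum>i. of_nat (j choose i) * (u - 1) ^ i)"
    by (simp add: one_unit_powr_def)
  also have "\<dots> = (\<Sum>i\<le>j. of_nat (j choose i) * (u - 1) ^ i)"
    by (rule suminf_finite) (auto simp: binomial_eq_0)
  also have "\<dots> = ((u - 1) + 1) ^ j" unfolding binomial_ring by simp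
  finally show ?thesis by simp
qed

lemma poly_to_fls_pCons: "poly_to_fls (pCons c f) = fls_const c + fls_X_inv * poly_to_fls f"
  by (simp add: poly_to_fls_def map_poly_pCons)

lemma poly_to_fls_0 [simp]: "poly_to_fls 0 = 0"
  by (simp add: poly_to_fls_def)

lemma poly_to_fls_1 [simp]: "poly_to_fls 1 = 1"
  by (simp add: one_pCons poly_to_fls_pCons)

lemma poly_to_fls_add: "poly_to_fls (f + g) = poly_to_fls f + poly_to_fls g"
  by (induction f g rule: poly_induct2) (simp_all add: poly_to_fls_pCons distrib_left fls_plus_const add_ac)

lemma poly_to_fls_smult: "poly_to_fls (Polynomial.smult c f) = fls_const c * poly_to_fls f"
  by (induction f) (simp_all add: poly_to_fls_pCons distrib_left mult.left_commute)

lemma poly_to_fls_mult: "poly_to_fls (f * g) = poly_to_fls f * poly_to_fls g"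
  by (induction f)
     (simp_all add: poly_to_fls_pCons poly_to_fls_add poly_to_fls_smult distrib_right mult.assoc)

text \<open>
  As \<open>T\<close> is the inverse of the variable, the coefficients of a polynomial sit at the nonpositive indices.
  In particular, the embedding of polynomials into Laurent series is injective.
\<close>

lemma poly_to_fls_nth: "fls_nth (poly_to_fls f) n = (if n \<le> 0 then Polynomial.coeff f (nat (- n)) else 0)"
proof (induction f arbitrary: n)
  case (pCons c f)
  have "fls_nth (poly_to_fls (pCons c f)) n = (if n = 0 then c else 0) + fls_nth (poly_to_fls f) (n + 1)"
    by (simp add: poly_to_fls_pCons fls_X_inv_times_conv_shift)
  also have "\<dots> = (if n \<le> 0 then Polynomial.coeff (pCons c f) (nat (- n)) else 0)"
  proof (cases "n < 0")
    case True
    then have "nat (- n) = Suc (nat (- (n + 1)))" by simp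
    then have "Polynomial.coeff (pCons c f) (nat (- n)) = Polynomial.coeff f (nat (- (n + 1)))"
      by (simp only: coeff_pCons_Suc)
    then show ?thesis using True by (simp add: pCons.IH)
  qed (auto simp: pCons.IH)
  finally show ?case .
qed simp

context completed_alg_closure
begin

lemma emb_0: "emb 0 = 0"
proof (rule add_left_imp_eq)
  show "emb 0 + emb 0 = emb 0 + 0" using emb_add[of 0 0] by (simp only: add_0_right)
qed

definition emb_poly :: "'a poly \<Rightarrow> 'c" where
  "emb_poly f = emb (to_ac (poly_to_fls f))"

lemma emb_power: "emb (x ^ n) = emb x ^ n"
  by (induction n) (simp_all add: emb_1 emb_mult)

lemma emb_eq_0_iff: "emb x = 0 \<longleftrightarrow> x = 0"
proof
  assume "emb x = 0"
  then have "emb (x * inverse x) = 0" by (simp add: emb_mult)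
  then show "x = 0" by (cases "x = 0") (simp_all add: emb_1)
qed (simp add: emb_0)

lemma emb_poly_0 [simp]: "emb_poly 0 = 0"
  by (simp add: emb_poly_def emb_0)

lemma emb_poly_1 [simp]: "emb_poly 1 = 1"
  by (simp add: emb_poly_def emb_1)

lemma emb_poly_add: "emb_poly (f + g) = emb_poly f + emb_poly g"
  by (simp add: emb_poly_def emb_add poly_to_fls_add)

lemma emb_poly_mult: "emb_poly (f * g) = emb_poly f * emb_poly g"
  by (simp add: emb_poly_def emb_mult poly_to_fls_mult)

lemma emb_poly_of_nat: "emb_poly (of_nat n) = of_nat n"
  by (induction n) (simp_all add: emb_poly_add)

lemma emb_poly_sum: "emb_poly (sum f I) = (\<Sum>i\<in>I. emb_poly (f i))"
  by (induction I rule: infinite_finite_induct) (simp_all add: emb_poly_add)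

lemma emb_poly_eq_0_iff: "emb_poly f = 0 \<longleftrightarrow> f = 0"
proof
  assume "emb_poly f = 0"
  then have "poly_to_fls f = 0" by (simp add: emb_poly_def emb_eq_0_iff)
  then have "Polynomial.coeff f n = 0" for n using poly_to_fls_nth[of f "- int n"] by simp
  then show "f = 0" by (simp add: poly_eq_iff)
qed simp

sublocale absolute_value "\<lambda>x :: 'c. dist x 0"
proof
  fix x y :: 'c
  show "dist x y = dist (x - y) 0" using dist_add_right[of x "- y" y] by simp
  show "dist (x * y) 0 = dist x 0 * dist y 0" by (rule dist_mult_0)
  have "dist (fls_X :: 'a fls) 0 = 1 / 2" by (simp add: dist_fls_def)
  then show "\<exists>x :: 'c. 0 < dist x 0 \<and> dist x 0 < 1"
    using dist_emb[of fls_X] by (intro exI[of _ "emb (to_ac fls_X)"]) simp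
qed

text \<open>
  The polynomial \<open>Z\<^sub>j(u)\<close> with its coefficients carried into the completed algebraic closure.
\<close>

definition zeta_poly :: "nat \<Rightarrow> 'c poly" where
  "zeta_poly j = (\<Sum>e\<le>j. Polynomial.monom (emb_poly (monic_power_sum e j)) e)"

lemma poly_zeta_poly_1: "poly (zeta_poly j) 1 = emb_poly (zeta_value j)"
  by (simp add: zeta_poly_def zeta_value_def poly_sum poly_monom emb_poly_sum)

lemma poly_pderiv_zeta_poly_1: "poly (pderiv (zeta_poly j)) 1 = emb_poly (zeta_deriv j)"
  by (simp add: zeta_poly_def zeta_deriv_def poly_sum poly_monom emb_poly_sum emb_poly_mult
                emb_poly_of_nat higher_pderiv_sum[of 1, simplified] pderiv_monom)

lemma emb_poly_power: "emb_poly (f ^ n) = emb_poly f ^ n"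
  by (induction n) (simp_all add: emb_poly_mult)

lemma emb_to_ac_sum: "emb (to_ac (sum f I)) = (\<Sum>i\<in>I. emb (to_ac (f i)))"
  by (induction I rule: infinite_finite_induct) (simp_all add: emb_0 emb_add)

text \<open>
  For monic \<open>f\<close> of degree \<open>e\<close> one has \<open>\<langle>f\<rangle> ^ j = (\<pi> ^ j) ^ e * f ^ j\<close>, so the powers of \<open>\<pi>\<close> combine with
  \<open>x ^ (- e)\<close> to powers of \<open>u = \<pi> ^ j / x\<close>.
\<close>

lemma zeta_A_at_neg: "zeta_A emb \<pi> x (- of_nat j) = poly (zeta_poly j) (emb (to_ac (\<pi> ^ j)) / x)"
proof -
  define x\<^sub>0 where "x\<^sub>0 = emb (to_ac (\<pi> ^ j))"
  have "inverse x ^ e * emb (to_ac (\<Sum>f\<in>monic_polys e. one_unit_powr (one_unit_part \<pi> f) (of_nat j)))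
        = emb_poly (monic_power_sum e j) * (x\<^sub>0 / x) ^ e" for e
  proof -
    have "emb (to_ac (one_unit_powr (one_unit_part \<pi> f) (of_nat j))) = x\<^sub>0 ^ e * emb_poly (f ^ j)"
      if "f \<in> monic_polys e" for f
      using that unfolding emb_poly_power
      by (simp add: one_unit_powr_of_nat one_unit_part_def monic_polys_def x\<^sub>0_def emb_poly_def
                    power_mult_distrib emb_mult emb_power mult.commute flip: power_mult)
    then have "emb (to_ac (\<Sum>f\<in>monic_polys e. one_unit_powr (one_unit_part \<pi> f) (of_nat j)))
        = x\<^sub>0 ^ e * emb_poly (monic_power_sum e j)"
      by (simp add: emb_to_ac_sum monic_power_sum_def emb_poly_sum sum_distrib_left)
    then show ?thesis by (simp add: divide_inverse power_mult_distrib)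
  qed
  then have "zeta_A emb \<pi> x (- of_nat j) = (\<Sum>e. emb_poly (monic_power_sum e j) * (x\<^sub>0 / x) ^ e)"
    by (simp add: zeta_A_def monic_polys_def)
  also have "\<dots> = (\<Sum>e\<le>j. emb_poly (monic_power_sum e j) * (x\<^sub>0 / x) ^ e)"
    by (rule suminf_finite) (auto simp: monic_power_sum_eq_0)
  also have "\<dots> = poly (zeta_poly j) (x\<^sub>0 / x)"
    by (simp add: zeta_poly_def poly_sum poly_monom)
  finally show ?thesis by (simp only: x\<^sub>0_def)
qed

text \<open>
  At \<open>x = \<pi> ^ j\<close>, that is, at \<open>u = 1\<close>, the polynomial \<open>Z\<^sub>j\<close> has a simple zero or none.
\<close>

lemma zeta_order_at_neg_eq:
  assumes "positive_uniformizer \<pi>" "j > 0"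
  shows "zeta_order_at_neg emb \<pi> j = (if (CARD('a) - 1) dvd j then 1 else 0)"
proof -
  define x\<^sub>0 where "x\<^sub>0 = emb (to_ac (\<pi> ^ j))"
  obtain u where u: "one_unit u" "\<pi> = fls_X * u"
    using assms(1) by (auto simp: positive_uniformizer_def)
  have "u \<noteq> 0" using u(1) by (auto simp: one_unit_def dist_fls_def)
  then have "x\<^sub>0 \<noteq> 0" using u(2) by (simp add: x\<^sub>0_def emb_eq_0_iff)
  note order = zero_order_poly_quotient[OF this, of "zeta_poly j"]
  have "zeta_order_at_neg emb \<pi> j = zero_order (\<lambda>x. poly (zeta_poly j) (x\<^sub>0 / x)) x\<^sub>0"
    by (simp only: zeta_order_at_neg_def zeta_A_at_neg x\<^sub>0_def)
  also have "\<dots> = (if (CARD('a) - 1) dvd j then 1 else 0)"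
  proof (cases "(CARD('a) - 1) dvd j")
    case True
    have "zeta_deriv j \<noteq> (0 :: 'a poly)" using zeta_deriv_at_0[OF assms(2) True] by auto
    then show ?thesis
      using True order(2) zeta_value_eq_0[OF assms(2) True]
      by (simp add: poly_zeta_poly_1 poly_pderiv_zeta_poly_1 emb_poly_eq_0_iff)
  next
    case False
    have "zeta_value j \<noteq> (0 :: 'a poly)" using zeta_value_at_0[OF False] by auto
    then show ?thesis
      using False order(1) by (simp add: poly_zeta_poly_1 emb_poly_eq_0_iff)
  qed
  finally show ?thesis .
qed

end

theorem proposition8:
  fixes emb :: "'a :: {field, finite} fls alg_closure \<Rightarrow> 'c :: {field, complete_space}"
    and \<pi> :: "'a fls"
    and \<sigma> :: "'a padic_int \<Rightarrow> 'a padic_int"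
    and j :: nat
  assumes "completed_alg_closure emb"
    and "positive_uniformizer \<pi>"
    and "\<sigma> \<in> S_q"
    and "j > 0"
  shows "\<exists>j'>0. \<sigma> (of_nat j) = of_nat j' \<and>
           zeta_order_at_neg emb \<pi> j = zeta_order_at_neg emb \<pi> j'"
proof -
  interpret completed_alg_closure emb by fact
  obtain \<rho> where \<sigma>: "\<sigma> = digit_perm \<rho>" using assms(3) by (auto simp: S_q_def)
  obtain j' where j': "j' > 0" "digit_perm \<rho> (of_nat j :: 'a padic_int) = of_nat j'"
    "j' mod (CARD('a) - 1) = j mod (CARD('a) - 1)"
    using digit_perm_of_nat[OF assms(4)] by blast
  have "zeta_order_at_neg emb \<pi> j = zeta_order_at_neg emb \<pi> j'"
    using j'(3) by (simp add: zeta_order_at_neg_eq assms j'(1) dvd_eq_mod_eq_0)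
  with j'(1,2) \<sigma> show ?thesis by blast
qed

end
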